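(* Let $k$ be a field with $\operatorname{char}(k)=0$, let $S=k[x_1,\dots,x_n]$, and let $I\subset S$ be a nonzero, proper homogeneous ideal with minimal primes $\operatorname{Min}(I)=\{\mathfrak p_1,\dots,\mathfrak p_r\}$. Let $\mathcal{RLP}(I)\subset T$ be the defining ideal of the Rees-like algebra $\mathcal{RL}(I)$, let $X=\operatorname{Proj}\,\mathcal{RL}(I)$, and let $J$ be the radical ideal of $T$ defining $\operatorname{Sing}(X)$. Then $$J=\bigl(\mathfrak p_1+(\underline y)\bigr)\cap\bigl(\mathfrak p_2+(\underline y)\bigr)\cap\cdots\cap\bigl(\mathfrak p_r+(\underline y)\bigr).$$ In particular: \begin{itemize} \item there is a one-to-one correspondence between $\operatorname{Min}(I)$ and $\operatorname{Min}(J)$; \item $\operatorname{ht}(J)=\mu(I)+\operatorname{ht}(I)$; and \item $\operatorname{codim}_X(\operatorname{Sing}X)=\operatorname{ht}(I)$. \end{itemize}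
   Context: $S$ is standard graded; $\mu(I)=m$ is the minimal number of generators of $I$ and $f_1,\dots,f_m$ are minimal homogeneous generators of $I$. The Rees-like algebra of $I$ is $\mathcal{RL}(I)=S[It,t^2]\subseteq S[t]$. Put $T=S[y_1,\dots,y_m,z]$, graded by $\deg x_i=1$, $\deg y_i=\deg f_i+1$, $\deg z=2$; $\mathcal{RLP}(I)$ is the kernel of the surjective $S$-algebra map $T\to\mathcal{RL}(I)$, $y_i\mapsto f_it$, $z\mapsto t^2$; it is a prime ideal of height $m$. Here $(\underline y)=(y_1,\dots,y_m)T$, and $\mathfrak p_i+(\underline y)$ denotes the ideal of $T$ generated by $\mathfrak p_i$ and $y_1,\dots,y_m$. For an ideal $H$, $\operatorname{Min}(H)$ is the set of its minimal primes. The singular locus of $X=\operatorname{Proj}(T/\mathcal{RLP}(I))$ is understood through the Jacobian criterion: the radical ideal $J\subset T$ is the one defining the singular locus of $\operatorname{Spec}(T/\mathcal{RLP}(I))$, i.e. the radical of the sum of $\mathcal{RLP}(I)$ and the ideal of $m\times m$ minors of the Jacobian matrix of a set of generators of $\mathcal{RLP}(I)$ with respect to all variables of $T$; and $\operatorname{codim}_X(\operatorname{Sing}X)=\operatorname{ht}(J)-\operatorname{ht}(\mathcal{RLP}(I))$. *)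

theory Defs
  imports "HOL-Analysis.Determinants" "HOL-Library.Poly_Mapping"
    "HOL-Computational_Algebra.Polynomial" "HOL-Library.Extended_Nat"
begin

section \<open>Ideals of a commutative ring\<close>

text \<open>A commutative ring is a module over itself; its ideals are the submodules.\<close>

global_interpretation ideal: module "(*) :: 'a::comm_ring_1 \<Rightarrow> 'a \<Rightarrow> 'a"
  defines is_ideal = ideal.subspace and ideal_span = ideal.span
  by unfold_locales (auto simp: algebra_simps)

definition prime_ideal :: "'a::comm_ring_1 set \<Rightarrow> bool" where
  "prime_ideal P \<longleftrightarrow> is_ideal P \<and> P \<noteq> UNIV \<and> (\<forall>a b. a * b \<in> P \<longrightarrow> a \<in> P \<or> b \<in> P)"

definition radical :: "'a::comm_ring_1 set \<Rightarrow> 'a set" where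
  "radical H = {a. \<exists>l. a ^ l \<in> H}"

definition minimal_primes :: "'a::comm_ring_1 set \<Rightarrow> 'a set set" where
  "minimal_primes H =
     {P. prime_ideal P \<and> H \<subseteq> P \<and> (\<forall>Q. prime_ideal Q \<and> H \<subseteq> Q \<and> Q \<subseteq> P \<longrightarrow> Q = P)}"

definition prime_height :: "'a::comm_ring_1 set \<Rightarrow> enat" where
  "prime_height P =
     Sup {enat l | l. \<exists>C :: nat \<Rightarrow> 'a set.
            (\<forall>i\<le>l. prime_ideal (C i)) \<and> (\<forall>i<l. C i \<subset> C (Suc i)) \<and> C l = P}"

definition height :: "'a::comm_ring_1 set \<Rightarrow> enat" where
  "height H = (INF P \<in> {P. prime_ideal P \<and> H \<subseteq> P}. prime_height P)"

text \<open>Minimal number of generators; meaningful for finitely generated ideals only.\<close>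

definition mu :: "'a::comm_ring_1 set \<Rightarrow> nat" where
  "mu H = (LEAST r. \<exists>A. finite A \<and> card A = r \<and> ideal_span A = H)"


section \<open>Multivariate polynomials\<close>

text \<open>The polynomial ring over \<open>'k\<close> with variables indexed by \<open>'v\<close>: finitely supported
  coefficient functions on the monomials, which are finitely supported exponent functions.\<close>

type_synonym ('v, 'k) mpoly = "('v \<Rightarrow>\<^sub>0 nat) \<Rightarrow>\<^sub>0 'k"

definition mconst :: "'k \<Rightarrow> ('v, 'k::comm_ring_1) mpoly" where
  "mconst c = Poly_Mapping.single 0 c"

definition mvar :: "'v \<Rightarrow> ('v, 'k::comm_ring_1) mpoly" where
  "mvar v = Poly_Mapping.single (Poly_Mapping.single v 1) 1"

definition meval :: "('k::comm_ring_1 \<Rightarrow> 'r::comm_ring_1) \<Rightarrow> ('v \<Rightarrow> 'r) \<Rightarrow> ('v, 'k) mpoly \<Rightarrow> 'r" where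
  "meval c g p = (\<Sum>a\<in>Poly_Mapping.keys p. c (Poly_Mapping.lookup p a) *
      (\<Prod>v\<in>Poly_Mapping.keys a. g v ^ Poly_Mapping.lookup a v))"

lemma meval_superset:
  assumes "c 0 = 0" "finite A" "Poly_Mapping.keys p \<subseteq> A"
  shows "meval c g p = (\<Sum>a\<in>A. c (Poly_Mapping.lookup p a) *
      (\<Prod>v\<in>Poly_Mapping.keys a. g v ^ Poly_Mapping.lookup a v))"
  unfolding meval_def using assms
  by (intro sum.mono_neutral_left) (auto simp: in_keys_iff)

lemma meval_single:
  assumes "c 0 = 0"
  shows "meval c g (Poly_Mapping.single a x) =
      c x * (\<Prod>v\<in>Poly_Mapping.keys a. g v ^ Poly_Mapping.lookup a v)"
  using meval_superset[of c "{a}" "Poly_Mapping.single a x" g] assms by simp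

lemma meval_mconst:
  assumes "c 0 = 0"
  shows "meval c g (mconst x) = c x"
  by (simp add: mconst_def meval_single assms)

lemma meval_mvar:
  assumes "c 0 = 0" "c 1 = 1"
  shows "meval c g (mvar v) = g v"
  by (simp add: mvar_def meval_single assms)

lemma meval_add:
  assumes "c 0 = 0" "\<And>x y. c (x + y) = c x + c y"
  shows "meval c g (p + q) = meval c g p + meval c g q"
proof -
  let ?A = "Poly_Mapping.keys p \<union> Poly_Mapping.keys q"
  have "Poly_Mapping.keys (p + q) \<subseteq> ?A" by (rule Poly_Mapping.keys_add)
  then show ?thesis
    using assms
    by (simp add: meval_superset[of c ?A] lookup_add sum.distrib algebra_simps)
qed

lemma meval_zero: "meval c g 0 = 0"
  by (simp add: meval_def)

lemma meval_sum:
  assumes "c 0 = 0" "\<And>x y. c (x + y) = c x + c y"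
  shows "meval c g (sum h A) = (\<Sum>a\<in>A. meval c g (h a))"
  by (induction A rule: infinite_finite_induct) (simp_all add: meval_zero meval_add[of c] assms)

lemma mpoly_sum_single:
  "p = (\<Sum>a\<in>Poly_Mapping.keys p. Poly_Mapping.single a (Poly_Mapping.lookup p a))"
  by (rule poly_mapping_eqI)
    (auto simp: lookup_sum lookup_single when_def in_keys_iff)

lemma monom_eval_add:
  fixes g :: "'v \<Rightarrow> 'r::comm_ring_1"
  shows "(\<Prod>v\<in>Poly_Mapping.keys (a + b). g v ^ Poly_Mapping.lookup (a + b) v) =
    (\<Prod>v\<in>Poly_Mapping.keys a. g v ^ Poly_Mapping.lookup a v) *
    (\<Prod>v\<in>Poly_Mapping.keys b. g v ^ Poly_Mapping.lookup b v)"
proof -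
  let ?A = "Poly_Mapping.keys a \<union> Poly_Mapping.keys b"
  have *: "(\<Prod>v\<in>Poly_Mapping.keys x. g v ^ Poly_Mapping.lookup x v) =
      (\<Prod>v\<in>?A. g v ^ Poly_Mapping.lookup x v)" if "Poly_Mapping.keys x \<subseteq> ?A" for x
    using that by (intro prod.mono_neutral_left) (auto simp: in_keys_iff)
  show ?thesis
    unfolding *[of a, OF Un_upper1] *[of b, OF Un_upper2] *[OF Poly_Mapping.keys_add]
    by (simp add: lookup_add power_add prod.distrib)
qed

lemma meval_mult:
  assumes "c 0 = 0" "\<And>x y. c (x + y) = c x + c y" "\<And>x y. c (x * y) = c x * c y"
  shows "meval c g (p * q) = meval c g p * meval c g q"
proof -
  let ?s = "\<lambda>p a. Poly_Mapping.single a (Poly_Mapping.lookup p a)"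
  have "p * q = (\<Sum>a\<in>Poly_Mapping.keys p. ?s p a) * (\<Sum>b\<in>Poly_Mapping.keys q. ?s q b)"
    by (rule arg_cong2[where f = "(*)", OF mpoly_sum_single mpoly_sum_single])
  also have "\<dots> = (\<Sum>a\<in>Poly_Mapping.keys p. \<Sum>b\<in>Poly_Mapping.keys q. ?s p a * ?s q b)"
    by (rule sum_product)
  finally have pq: "p * q = \<dots>" .
  have m: "meval c g (?s p a * ?s q b) = meval c g (?s p a) * meval c g (?s q b)" for a b
    unfolding mult_single meval_single[of c, OF assms(1)] monom_eval_add assms(3)
    by (simp only: mult_ac)
  have "meval c g (p * q) = (\<Sum>a\<in>Poly_Mapping.keys p. \<Sum>b\<in>Poly_Mapping.keys q.
      meval c g (?s p a) * meval c g (?s q b))"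
    by (simp only: pq meval_sum[of c, OF assms(1,2)] m)
  also have "\<dots> = (\<Sum>a\<in>Poly_Mapping.keys p. meval c g (?s p a)) *
      (\<Sum>b\<in>Poly_Mapping.keys q. meval c g (?s q b))"
    by (rule sum_product[symmetric])
  also have "\<dots> = meval c g p * meval c g q"
    unfolding meval_single[of c, OF assms(1)] by (simp only: meval_def)
  finally show ?thesis .
qed

text \<open>Subtraction of exponents is truncated, but where it truncates the coefficient is \<open>0\<close>.\<close>

definition mderiv :: "'v \<Rightarrow> ('v, 'k::comm_ring_1) mpoly \<Rightarrow> ('v, 'k) mpoly" where
  "mderiv v p = (\<Sum>a\<in>Poly_Mapping.keys p. Poly_Mapping.single (a - Poly_Mapping.single v 1)
      (of_nat (Poly_Mapping.lookup a v) * Poly_Mapping.lookup p a))"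

definition monom_deg :: "('v \<Rightarrow>\<^sub>0 nat) \<Rightarrow> nat" where
  "monom_deg a = (\<Sum>v\<in>Poly_Mapping.keys a. Poly_Mapping.lookup a v)"

definition homogeneous :: "('v, 'k::comm_ring_1) mpoly \<Rightarrow> bool" where
  "homogeneous p \<longleftrightarrow> (\<exists>d. \<forall>a\<in>Poly_Mapping.keys p. monom_deg a = d)"

definition hom_component :: "nat \<Rightarrow> ('v, 'k::comm_ring_1) mpoly \<Rightarrow> ('v, 'k) mpoly" where
  "hom_component d p =
     (\<Sum>a\<in>{a \<in> Poly_Mapping.keys p. monom_deg a = d}. Poly_Mapping.single a (Poly_Mapping.lookup p a))"

definition homogeneous_ideal :: "('v, 'k::comm_ring_1) mpoly set \<Rightarrow> bool" where
  "homogeneous_ideal H \<longleftrightarrow> is_ideal H \<and> (\<forall>p\<in>H. \<forall>d. hom_component d p \<in> H)"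

text \<open>The family \<open>f\<close> has \<open>CARD('m)\<close> members; requiring this to be \<open>mu H\<close> also makes
  \<open>f\<close> injective and irredundant.\<close>

definition minimal_homogeneous_generators ::
    "('m::finite \<Rightarrow> ('v, 'k::comm_ring_1) mpoly) \<Rightarrow> ('v, 'k) mpoly set \<Rightarrow> bool" where
  "minimal_homogeneous_generators f H \<longleftrightarrow>
     (\<forall>i. homogeneous (f i)) \<and> ideal_span (range f) = H \<and> CARD('m) = mu H"


section \<open>The Rees-like algebra and its defining ideal\<close>

text \<open>With \<open>S\<close> the polynomial ring in variables \<open>'n\<close>, the ring \<open>S[t]\<close> is the type of univariate
  polynomials over \<open>S\<close>: \<open>[:a:]\<close> is \<open>a \<in> S\<close>, \<open>[:0, a:]\<close> is \<open>a t\<close> and \<open>[:0, 0, 1:]\<close> is \<open>t^2\<close>.\<close>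

definition rees_like_algebra ::
    "('n, 'k::comm_ring_1) mpoly set \<Rightarrow> ('n, 'k) mpoly poly set" where
  "rees_like_algebra H =
     \<Inter> {A. range (\<lambda>a. [:a:]) \<subseteq> A \<and> (\<lambda>a. [:0, a:]) ` H \<subseteq> A \<and> [:0, 0, 1:] \<in> A \<and>
         (\<forall>p\<in>A. \<forall>q\<in>A. p + q \<in> A \<and> p * q \<in> A)}"

datatype ('n, 'm) tvar = XV 'n | YV 'm | ZV

fun rees_like_var ::
    "('m \<Rightarrow> ('n, 'k::comm_ring_1) mpoly) \<Rightarrow> ('n, 'm) tvar \<Rightarrow> ('n, 'k) mpoly poly" where
  "rees_like_var f (XV i) = [:mvar i:]"
| "rees_like_var f (YV j) = [:0, f j:]"
| "rees_like_var f ZV = [:0, 0, 1:]"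

definition rees_like_map ::
    "('m \<Rightarrow> ('n, 'k::comm_ring_1) mpoly) \<Rightarrow> (('n, 'm) tvar, 'k) mpoly \<Rightarrow> ('n, 'k) mpoly poly" where
  "rees_like_map f = meval (\<lambda>c. [:mconst c:]) (rees_like_var f)"

definition RLP :: "('m \<Rightarrow> ('n, 'k::comm_ring_1) mpoly) \<Rightarrow> (('n, 'm) tvar, 'k) mpoly set" where
  "RLP f = {p. rees_like_map f p = 0}"

lemma rees_like_map_simps:
  "rees_like_map f (mconst x) = [:mconst x:]"
  "rees_like_map f (mvar v) = rees_like_var f v"
  "rees_like_map f (p + q) = rees_like_map f p + rees_like_map f q"
  "rees_like_map f (p * q) = rees_like_map f p * rees_like_map f q"
  unfolding rees_like_map_def
     apply (subst meval_mconst; simp add: mconst_def)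
    apply (subst meval_mvar; simp add: mconst_def one_pCons)
   apply (rule meval_add; simp add: mconst_def single_add)
  apply (rule meval_mult; simp add: mconst_def single_add mult_single mult.commute)
  done

lemma mpoly_induct [case_names const var add mult]:
  fixes p :: "('v, 'k::comm_ring_1) mpoly"
  assumes "\<And>x. P (mconst x)" "\<And>v. P (mvar v)"
    and add: "\<And>p q. P p \<Longrightarrow> P q \<Longrightarrow> P (p + q)" and mult: "\<And>p q. P p \<Longrightarrow> P q \<Longrightarrow> P (p * q)"
  shows "P p"
proof -
  have P01: "P 0" "P 1"
    using assms(1)[of 0] assms(1)[of 1] by (simp_all add: mconst_def)
  have pow: "P (mvar v ^ l)" for v l
    by (induction l) (auto simp: P01 assms)
  have prod: "P (\<Prod>v\<in>A. mvar v ^ h v)" for A and h :: "'v \<Rightarrow> nat"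
    by (induction A rule: infinite_finite_induct) (auto simp: P01 pow mult)
  have mono: "P (mconst x * (\<Prod>v\<in>A. mvar v ^ h v))" for x A and h :: "'v \<Rightarrow> nat"
    by (intro mult assms(1) prod)
  have sum: "P (\<Sum>a\<in>B. w a)" if "\<And>a. P (w a)" for B and w :: "('v \<Rightarrow>\<^sub>0 nat) \<Rightarrow> ('v, 'k) mpoly"
    by (induction B rule: infinite_finite_induct) (auto simp: P01 add that)
  have pow_eq: "(mvar v :: ('v, 'k) mpoly) ^ l = Poly_Mapping.single (Poly_Mapping.single v l) 1" for v l
    by (induction l) (auto simp: mvar_def mult_single single_add[symmetric])
  have prod_eq: "(\<Prod>v\<in>A. (mvar v :: ('v, 'k) mpoly) ^ h v) =
      Poly_Mapping.single (\<Sum>v\<in>A. Poly_Mapping.single v (h v)) 1" for A and h :: "'v \<Rightarrow> nat"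
    by (induction A rule: infinite_finite_induct) (auto simp: pow_eq mult_single)
  have "p = (\<Sum>a\<in>Poly_Mapping.keys p. Poly_Mapping.single a (Poly_Mapping.lookup p a))"
    by (rule mpoly_sum_single)
  also have "\<dots> = (\<Sum>a\<in>Poly_Mapping.keys p. mconst (Poly_Mapping.lookup p a) *
      (\<Prod>v\<in>Poly_Mapping.keys a. mvar v ^ Poly_Mapping.lookup a v))"
  proof (rule sum.cong[OF refl])
    fix a assume "a \<in> Poly_Mapping.keys p"
    have "a = (\<Sum>v\<in>Poly_Mapping.keys a. Poly_Mapping.single v (Poly_Mapping.lookup a v))"
      by (rule poly_mapping_eqI) (auto simp: lookup_sum lookup_single when_def in_keys_iff)
    then show "Poly_Mapping.single a (Poly_Mapping.lookup p a) =
        mconst (Poly_Mapping.lookup p a) * (\<Prod>v\<in>Poly_Mapping.keys a. mvar v ^ Poly_Mapping.lookup a v)"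
      by (simp add: prod_eq mconst_def mult_single)
  qed
  finally have p_eq: "p = \<dots>" .
  show ?thesis
    by (subst p_eq, rule sum, rule mono)
qed

lemma range_rees_like_map:
  fixes f :: "'m \<Rightarrow> ('n, 'k::comm_ring_1) mpoly"
  shows "range (rees_like_map f) = rees_like_algebra (ideal_span (range f))"
proof
  show "range (rees_like_map f) \<subseteq> rees_like_algebra (ideal_span (range f))"
  proof (clarsimp simp: rees_like_algebra_def)
    fix A :: "('n, 'k) mpoly poly set" and p :: "(('n, 'm) tvar, 'k) mpoly"
    assume A: "range (\<lambda>a. [:a:]) \<subseteq> A" "(\<lambda>a. [:0, a:]) ` ideal_span (range f) \<subseteq> A"
      "[:0, 0, 1:] \<in> A" "\<forall>p\<in>A. \<forall>q\<in>A. p + q \<in> A \<and> p * q \<in> A"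
    have v: "rees_like_var f v \<in> A" for v
    proof (cases v)
      case (YV j)
      have "f j \<in> ideal_span (range f)"
        by (simp add: ideal.span_base)
      then show ?thesis using A(2) YV by auto
    qed (use A(1,3) in auto)
    show "rees_like_map f p \<in> A"
      by (induction p rule: mpoly_induct) (use A v in \<open>auto simp: rees_like_map_simps\<close>)
  qed
next
  let ?R = "range (rees_like_map f)"
  have cl: "p + q \<in> ?R" "p * q \<in> ?R" if pq: "p \<in> ?R" "q \<in> ?R" for p q
  proof -
    from pq obtain a b where "p = rees_like_map f a" "q = rees_like_map f b" by blast
    then show "p + q \<in> ?R" "p * q \<in> ?R"
      by (simp_all flip: rees_like_map_simps(3,4))
  qed
  have const: "[:a:] \<in> ?R" for a
  proof (induction a rule: mpoly_induct)
    case (const x)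
    show ?case by (rule range_eqI[of _ _ "mconst x"]) (simp add: rees_like_map_simps)
  next
    case (var v)
    show ?case by (rule range_eqI[of _ _ "mvar (XV v)"]) (simp add: rees_like_map_simps)
  next
    case (add p q)
    then show ?case using cl(1)[of "[:p:]" "[:q:]"] by simp
  next
    case (mult p q)
    then show ?case using cl(2)[of "[:p:]" "[:q:]"] by (simp add: mult.commute)
  qed
  have t2: "[:0, 0, 1:] \<in> ?R"
    by (rule range_eqI[of _ _ "mvar ZV"]) (simp add: rees_like_map_simps)
  have t: "[:0, f j:] \<in> ?R" for j
    by (rule range_eqI[of _ _ "mvar (YV j)"]) (simp add: rees_like_map_simps)
  have "[:0, a:] \<in> ?R" if "a \<in> ideal_span (range f)" for a
    using that
  proof (induction rule: ideal.span_induct_alt)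
    case base
    show ?case using const[of 0] by simp
  next
    case (step c x y)
    then obtain j where "x = f j" by auto
    then have "[:c:] * [:0, x:] + [:0, y:] \<in> ?R"
      by (intro cl const step t) (use t in simp)
    then show ?case by (simp add: mult.commute)
  qed
  then show "rees_like_algebra (ideal_span (range f)) \<subseteq> ?R"
    unfolding rees_like_algebra_def using const t2 cl by (intro Inter_lower) auto
qed

definition S_to_T :: "('n, 'k::comm_ring_1) mpoly \<Rightarrow> (('n, 'm) tvar, 'k) mpoly" where
  "S_to_T = meval mconst (\<lambda>i. mvar (XV i))"

definition plus_y :: "('n, 'k::comm_ring_1) mpoly set \<Rightarrow> (('n, 'm) tvar, 'k) mpoly set" where
  "plus_y H = ideal_span (S_to_T ` H \<union> range (\<lambda>j. mvar (YV j)))"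


section \<open>The singular locus\<close>

text \<open>The minors of size \<open>CARD('m)\<close> of the Jacobian matrix of \<open>G\<close> with respect to all variables
  of \<open>T\<close>. A minor is a choice of distinct rows \<open>g\<close> and distinct columns \<open>v\<close>; their order only
  affects the sign. The set \<open>G\<close> may be infinite.\<close>

definition jacobian_minors ::
    "(('n, 'm::finite) tvar, 'k::comm_ring_1) mpoly set \<Rightarrow> (('n, 'm) tvar, 'k) mpoly set" where
  "jacobian_minors G =
     {det ((\<chi> i j. mderiv (v j) (g i)) :: (('n, 'm) tvar, 'k) mpoly ^ 'm ^ 'm) | g v.
        inj g \<and> range g \<subseteq> G \<and> inj v}"

definition singular_ideal ::
    "('m::finite \<Rightarrow> ('n, 'k::comm_ring_1) mpoly) \<Rightarrow> (('n, 'm) tvar, 'k) mpoly set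
      \<Rightarrow> (('n, 'm) tvar, 'k) mpoly set" where
  "singular_ideal f G = radical (ideal_span (RLP f \<union> jacobian_minors G))"

text \<open>The codimension, in the scheme cut out by \<open>H\<close>, of the closed subscheme cut out by a larger
  ideal \<open>J\<close>.\<close>

definition codim_in :: "'a::comm_ring_1 set \<Rightarrow> 'a set \<Rightarrow> enat" where
  "codim_in H J = height J - height H"

end

theory Submission
  imports Defs
begin

text \<open>
  Write \<open>m\<close> for the number of generators \<open>f\<^sub>j\<close> of \<open>I\<close>. The singular ideal \<open>J\<close> is a radical, hence the
  intersection of the primes \<open>Q\<close> that contain \<open>RLP f\<close> and the Jacobian minors, and the claim about \<open>J\<close>
  is that these are exactly the primes containing \<open>I\<close> and all \<open>y\<^sub>j\<close> (\<open>prime_over_singular_iff\<close>).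

  If \<open>Q\<close> contains the minors of the generators \<open>G\<close>, it contains those of all elements of \<open>RLP f\<close>, because
  modulo \<open>RLP f\<close> differentiation is linear on \<open>RLP f\<close>. The elements \<open>f\<^sub>k y\<^sub>i - f\<^sub>i y\<^sub>k\<close> and
  \<open>y\<^sub>k\<^sup>2 - z f\<^sub>k\<^sup>2\<close> of \<open>RLP f\<close> have a diagonal minor that is a power of \<open>f\<^sub>k\<close> up to sign, so \<open>f\<^sub>k\<close> and
  then \<open>y\<^sub>k\<close> lie in \<open>Q\<close>. Conversely, \<open>RLP f\<close> is generated by the quadrics \<open>y\<^sub>i y\<^sub>j - z f\<^sub>i f\<^sub>j\<close> and the
  linear forms \<open>\<Sum>\<^sub>j c\<^sub>j y\<^sub>j\<close> with \<open>\<Sum>\<^sub>j c\<^sub>j f\<^sub>j = 0\<close>. Modulo \<open>(I, y)\<close> the former have zero differential, and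
  the latter contribute rows that are syzygies of \<open>f\<close>. Since \<open>f \<noteq> 0\<close>, any \<open>m\<close> syzygies are linearly
  dependent, so all minors vanish modulo \<open>(I, y)\<close>.

  A prime \<open>Q\<close> containing \<open>(I, y)\<close> contains \<open>(P, y)\<close> for its contraction \<open>P\<close> to \<open>S\<close>, and \<open>(P, y)\<close> is prime
  with contraction \<open>P\<close>. The minimal primes of \<open>J\<close> are therefore the \<open>(P, y)\<close> with \<open>P\<close> minimal over \<open>I\<close>.

  For the heights it remains to see that \<open>(P, y)\<close> has height \<open>m\<close> plus that of \<open>P\<close>, and that \<open>RLP f\<close>
  has height \<open>m\<close>. Both follow from the dimension formula for a polynomial ring over a field
  (\<open>prime_height_eq\<close>): the height of a prime is the number of variables outside a transcendence basis
  of variables modulo that prime. A chain of this length comes from contracting the prime to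
  polynomial subrings that grow by one variable at a time; longer chains are impossible because each
  step down a chain enlarges an algebraically independent family, and there are never more
  independent polynomials than variables. The bases are a basis for \<open>P\<close> together with \<open>z\<close> in the first
  case, and all \<open>x\<^sub>i\<close> together with \<open>z\<close> in the second.
\<close>

abbreviation lookup where "lookup \<equiv> Poly_Mapping.lookup"
abbreviation keys where "keys \<equiv> Poly_Mapping.keys"
abbreviation single where "single \<equiv> Poly_Mapping.single"

section \<open>Ring maps and prime ideals\<close>

locale ring_map =
  fixes h :: "'a::comm_ring_1 \<Rightarrow> 'b::comm_ring_1"
  assumes hom_one: "h 1 = 1"
    and hom_add: "h (a + b) = h a + h b"
    and hom_mult: "h (a * b) = h a * h b"
begin

lemma hom_zero: "h 0 = 0"
  using hom_add[of 0 0] by simp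

lemma hom_uminus: "h (- a) = - h a"
  using hom_add[of a "- a"] hom_zero by (simp add: eq_neg_iff_add_eq_0 add.commute)

lemma hom_diff: "h (a - b) = h a - h b"
  using hom_add[of a "- b"] by (simp add: hom_uminus)

lemma hom_sum: "h (sum w A) = (\<Sum>a\<in>A. h (w a))"
  by (induction A rule: infinite_finite_induct) (simp_all add: hom_zero hom_add)

end

lemma ring_map_mconst: "ring_map (mconst :: 'k::comm_ring_1 \<Rightarrow> ('v, 'k) mpoly)"
  by unfold_locales (simp_all add: mconst_def single_add mult_single)

lemma ring_map_comp: "ring_map g \<Longrightarrow> ring_map h \<Longrightarrow> ring_map (\<lambda>a. g (h a))"
  by (simp add: ring_map_def)

lemma ring_map_pCons: "ring_map (\<lambda>a. [:a:])"
  by unfold_locales (simp_all add: one_pCons)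

lemma ring_map_id: "ring_map (\<lambda>a. a)"
  by unfold_locales simp_all

lemma ring_map_meval:
  assumes "ring_map c"
  shows "ring_map (meval c g)"
proof -
  interpret ring_map c by fact
  show ?thesis
  proof
    have "meval c g (mconst 1) = 1"
      by (simp add: meval_mconst hom_zero hom_one)
    then show "meval c g 1 = 1" by (simp add: mconst_def)
  qed (auto intro!: meval_add meval_mult simp: hom_zero hom_add hom_mult)
qed

lemma meval_mconst_hom: "ring_map c \<Longrightarrow> meval c g (mconst x) = c x"
  by (simp add: meval_mconst ring_map.hom_zero)

lemma meval_mvar_hom: "ring_map c \<Longrightarrow> meval c g (mvar v) = g v"
  by (simp add: meval_mvar ring_map.hom_zero ring_map.hom_one)

lemmas meval_simps = meval_mconst_hom meval_mvar_hom
  ring_map.hom_add[OF ring_map_meval] ring_map.hom_mult[OF ring_map_meval]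

lemma mpoly_hom_eqI:
  fixes g h :: "('v, 'k::comm_ring_1) mpoly \<Rightarrow> 'r::comm_ring_1"
  assumes "ring_map g" "ring_map h" "\<And>x. g (mconst x) = h (mconst x)" "\<And>v. g (mvar v) = h (mvar v)"
  shows "g p = h p"
  by (induction p rule: mpoly_induct)
    (simp_all add: assms(3,4) ring_map.hom_add[OF assms(1)] ring_map.hom_add[OF assms(2)]
      ring_map.hom_mult[OF assms(1)] ring_map.hom_mult[OF assms(2)])

lemma is_ideal_zero: "is_ideal H \<Longrightarrow> 0 \<in> H"
  by (rule ideal.subspace_0)

lemma is_ideal_add: "is_ideal H \<Longrightarrow> a \<in> H \<Longrightarrow> b \<in> H \<Longrightarrow> a + b \<in> H"
  by (rule ideal.subspace_add)

lemma is_ideal_scale: "is_ideal H \<Longrightarrow> a \<in> H \<Longrightarrow> c * a \<in> H"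
  by (rule ideal.subspace_scale)

lemma is_ideal_scale2: "is_ideal H \<Longrightarrow> a \<in> H \<Longrightarrow> a * c \<in> H"
  using is_ideal_scale[of H a c] by (simp add: mult.commute)

lemma is_ideal_diff: "is_ideal H \<Longrightarrow> a \<in> H \<Longrightarrow> b \<in> H \<Longrightarrow> a - b \<in> H"
  by (rule ideal.subspace_diff)

lemma is_ideal_sum: "is_ideal H \<Longrightarrow> (\<And>i. i \<in> A \<Longrightarrow> w i \<in> H) \<Longrightarrow> sum w A \<in> H"
  by (rule ideal.subspace_sum)

lemma is_ideal_span: "is_ideal (ideal_span H)"
  by (rule ideal.subspace_span)

lemma ideal_span_minimal: "is_ideal K \<Longrightarrow> H \<subseteq> K \<Longrightarrow> ideal_span H \<subseteq> K"
  by (rule ideal.span_minimal)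

lemma prime_idealD:
  assumes "prime_ideal P"
  shows prime_ideal_is_ideal: "is_ideal P" and prime_ideal_one: "1 \<notin> P"
    and prime_ideal_mult: "a * b \<in> P \<longleftrightarrow> a \<in> P \<or> b \<in> P"
    and prime_ideal_power: "a ^ l \<in> P \<Longrightarrow> a \<in> P"
proof -
  show i: "is_ideal P" using assms by (simp add: prime_ideal_def)
  show one: "1 \<notin> P"
  proof
    assume "1 \<in> P"
    then have "a * 1 \<in> P" for a using i is_ideal_scale by blast
    then show False using assms by (auto simp: prime_ideal_def)
  qed
  show m: "a * b \<in> P \<longleftrightarrow> a \<in> P \<or> b \<in> P" for a b
    using assms is_ideal_scale[OF i] is_ideal_scale2[OF i] by (auto simp: prime_ideal_def)
  show "a ^ l \<in> P \<Longrightarrow> a \<in> P"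
    by (induction l) (auto simp: one m)
qed

lemma prime_idealI:
  assumes "is_ideal P" "1 \<notin> P" "\<And>a b. a * b \<in> P \<Longrightarrow> a \<notin> P \<Longrightarrow> b \<in> P"
  shows "prime_ideal P"
  using assms by (auto simp: prime_ideal_def)

lemma is_ideal_vimage:
  assumes "ring_map h" "is_ideal P"
  shows "is_ideal (h -` P)"
  using assms
  by (auto simp: ideal.subspace_def ring_map.hom_zero ring_map.hom_add ring_map.hom_mult)

lemma prime_ideal_vimage:
  assumes "ring_map h" "prime_ideal P"
  shows "prime_ideal (h -` P)"
  using is_ideal_vimage[OF assms(1) prime_ideal_is_ideal[OF assms(2)]] prime_ideal_one[OF assms(2)]
  by (intro prime_idealI)
    (auto simp: ring_map.hom_one[OF assms(1)] ring_map.hom_mult[OF assms(1)] prime_ideal_mult[OF assms(2)])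

lemma prime_ideal_zero_idom: "prime_ideal {0 :: 'a::idom}"
  by (intro prime_idealI) (auto simp: ideal.subspace_def)

lemma is_ideal_coeffs:
  assumes "is_ideal H"
  shows "is_ideal {u :: 'a::comm_ring_1 poly. \<forall>k. coeff u k \<in> H}"
  by (auto simp: ideal.subspace_def is_ideal_zero[OF assms] coeff_mult
      intro!: is_ideal_add[OF assms] is_ideal_sum[OF assms] is_ideal_scale[OF assms])

text \<open>The product of two polynomials with coefficients outside of \<open>P\<close> has, at the sum of the lowest
  such positions, a coefficient that is outside of \<open>P\<close>.\<close>

lemma prime_ideal_coeffs:
  fixes P :: "'a::comm_ring_1 set"
  assumes P: "prime_ideal P"
  shows "prime_ideal {u :: 'a poly. \<forall>k. coeff u k \<in> P}" (is "prime_ideal ?E")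
proof (rule prime_idealI)
  note i = prime_ideal_is_ideal[OF P]
  show "is_ideal ?E" by (rule is_ideal_coeffs[OF i])
  have "coeff 1 0 \<notin> P" using prime_ideal_one[OF P] by simp
  then show "1 \<notin> ?E" by blast
  fix p q :: "'a poly" assume pq: "p * q \<in> ?E" "p \<notin> ?E"
  show "q \<in> ?E"
  proof (rule ccontr)
    assume "q \<notin> ?E"
    define a where "a = (LEAST k. coeff p k \<notin> P)"
    define b where "b = (LEAST k. coeff q k \<notin> P)"
    have a: "coeff p a \<notin> P" "\<And>k. k < a \<Longrightarrow> coeff p k \<in> P"
      unfolding a_def using pq(2) LeastI_ex[of "\<lambda>k. coeff p k \<notin> P"] not_less_Least[of _ "\<lambda>k. coeff p k \<notin> P"]
      by blast+
    have b: "coeff q b \<notin> P" "\<And>k. k < b \<Longrightarrow> coeff q k \<in> P"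
      unfolding b_def using \<open>q \<notin> ?E\<close> LeastI_ex[of "\<lambda>k. coeff q k \<notin> P"]
        not_less_Least[of _ "\<lambda>k. coeff q k \<notin> P"]
      by blast+
    have "(\<Sum>k\<in>{..a + b} - {a}. coeff p k * coeff q (a + b - k)) \<in> P"
    proof (rule is_ideal_sum[OF i])
      fix k assume "k \<in> {..a + b} - {a}"
      then have "k < a \<or> a + b - k < b" by auto
      then show "coeff p k * coeff q (a + b - k) \<in> P"
        using a(2) b(2) is_ideal_scale[OF i] is_ideal_scale2[OF i] by blast
    qed
    moreover have "coeff (p * q) (a + b) = coeff p a * coeff q b +
        (\<Sum>k\<in>{..a + b} - {a}. coeff p k * coeff q (a + b - k))"
      by (subst coeff_mult, subst sum.remove[of _ a]) auto
    ultimately have "coeff p a * coeff q b \<in> P"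
      using pq(1) is_ideal_diff[OF i] by (metis (no_types, lifting) add_diff_cancel_right' mem_Collect_eq)
    then show False using a b prime_ideal_mult[OF P] by blast
  qed
qed

lemma prime_ideal_zero_poly:
  assumes "prime_ideal {0 :: 'a::comm_ring_1}"
  shows "prime_ideal {0 :: 'a poly}"
proof -
  have "{u :: 'a poly. \<forall>k. coeff u k \<in> {0}} = {0}" by (auto intro: poly_eqI)
  then show ?thesis using prime_ideal_coeffs[OF assms] by simp
qed

lemma lookup_mult_finite:
  fixes p q :: "('v, 'r::comm_ring_1) mpoly"
  shows "lookup (p * q) c = (\<Sum>(x, y)\<in>keys p \<times> keys q. lookup p x * lookup q y when x + y = c)"
proof -
  have "p * q = (\<Sum>x\<in>keys p. single x (lookup p x)) *
      (\<Sum>y\<in>keys q. single y (lookup q y))"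
    by (rule arg_cong2[where f = "(*)", OF mpoly_sum_single mpoly_sum_single])
  also have "\<dots> = (\<Sum>(x, y)\<in>keys p \<times> keys q. single (x + y) (lookup p x * lookup q y))"
    by (simp add: sum_product sum.cartesian_product mult_single)
  finally show ?thesis
    by (simp add: lookup_sum lookup_single case_prod_beta)
qed

text \<open>The monomials in finitely many variables embed, compatibly with multiplication, into a
  totally ordered monoid.\<close>

lemma ex_monomial_order:
  "\<exists>\<kappa> :: ('v::finite \<Rightarrow>\<^sub>0 nat) \<Rightarrow> (nat \<Rightarrow>\<^sub>0 nat). inj \<kappa> \<and> (\<forall>a b. \<kappa> (a + b) = \<kappa> a + \<kappa> b)"
proof -
  obtain e :: "'v \<Rightarrow> nat" where e: "inj e"
    using finite_imp_inj_to_nat_seg[of "UNIV :: 'v set"] by blast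
  define \<kappa> :: "('v \<Rightarrow>\<^sub>0 nat) \<Rightarrow> (nat \<Rightarrow>\<^sub>0 nat)" where "\<kappa> a = (\<Sum>v\<in>UNIV. single (e v) (lookup a v))" for a
  have "lookup (\<kappa> a) (e w) = lookup a w" for a w
    using e by (simp add: \<kappa>_def lookup_sum lookup_single when_def inj_eq)
  then have "inj \<kappa>"
    by (intro injI poly_mapping_eqI) metis
  moreover have "\<kappa> (a + b) = \<kappa> a + \<kappa> b" for a b
    by (simp add: \<kappa>_def lookup_add single_add sum.distrib)
  ultimately show ?thesis by blast
qed

text \<open>As in one variable, with the highest, in a monomial order, among the monomials whose
  coefficients are outside of \<open>P\<close>.\<close>

lemma prime_ideal_mpoly_coeffs:
  fixes P :: "'r::comm_ring_1 set"
  assumes P: "prime_ideal P"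
  shows "prime_ideal {p :: ('v::finite, 'r) mpoly. \<forall>a. lookup p a \<in> P}" (is "prime_ideal ?E")
proof (rule prime_idealI)
  note i = prime_ideal_is_ideal[OF P]
  show "is_ideal ?E"
    by (auto simp: ideal.subspace_def is_ideal_zero[OF i] lookup_mult_finite lookup_add when_def
      intro!: is_ideal_add[OF i] is_ideal_sum[OF i] is_ideal_scale[OF i])
  have "lookup (1 :: ('v, 'r) mpoly) 0 \<notin> P" using prime_ideal_one[OF P] by simp
  then show "1 \<notin> ?E" by blast
  obtain \<kappa> :: "('v \<Rightarrow>\<^sub>0 nat) \<Rightarrow> (nat \<Rightarrow>\<^sub>0 nat)"
    where \<kappa>: "inj \<kappa>" "\<And>a b. \<kappa> (a + b) = \<kappa> a + \<kappa> b"
    using ex_monomial_order by blast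
  have top: "\<exists>a. lookup p a \<notin> P \<and> (\<forall>b. lookup p b \<notin> P \<longrightarrow> \<kappa> b \<le> \<kappa> a)" if "p \<notin> ?E" for p
  proof -
    let ?B = "{a. lookup p a \<notin> P}"
    have "?B \<subseteq> keys p" using is_ideal_zero[OF i] by (auto simp: in_keys_iff)
    then have "finite ?B" by (rule finite_subset) simp
    moreover have "?B \<noteq> {}" using that by auto
    ultimately have "Max (\<kappa> ` ?B) \<in> \<kappa> ` ?B" "\<forall>b\<in>?B. \<kappa> b \<le> Max (\<kappa> ` ?B)" by auto
    then show ?thesis by auto
  qed
  fix p q :: "('v, 'r) mpoly" assume pq: "p * q \<in> ?E" "p \<notin> ?E"
  show "q \<in> ?E"
  proof (rule ccontr)
    assume "q \<notin> ?E"
    from top[OF pq(2)] obtain a where a: "lookup p a \<notin> P" "\<And>x. lookup p x \<notin> P \<Longrightarrow> \<kappa> x \<le> \<kappa> a"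
      by blast
    from top[OF \<open>q \<notin> ?E\<close>] obtain b where b: "lookup q b \<notin> P" "\<And>x. lookup q x \<notin> P \<Longrightarrow> \<kappa> x \<le> \<kappa> b"
      by blast
    let ?s = "\<lambda>(x, y). lookup p x * lookup q y when x + y = a + b"
    have "sum ?s (keys p \<times> keys q - {(a, b)}) \<in> P"
    proof (rule is_ideal_sum[OF i])
      fix z assume "z \<in> keys p \<times> keys q - {(a, b)}"
      then obtain x y where z: "z = (x, y)" and ne: "(x, y) \<noteq> (a, b)" by (cases z) auto
      have "(lookup p x * lookup q y when x + y = a + b) \<in> P"
      proof (cases "x + y = a + b \<and> lookup p x \<notin> P \<and> lookup q y \<notin> P")
        case True
        then have le: "\<kappa> x \<le> \<kappa> a" "\<kappa> y \<le> \<kappa> b" "\<kappa> x + \<kappa> y = \<kappa> a + \<kappa> b"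
          using a b \<kappa>(2) by (blast, blast, metis)
        then have "\<kappa> x = \<kappa> a \<and> \<kappa> y = \<kappa> b"
          by (metis add_less_le_mono add_le_less_mono order_less_le)
        then show ?thesis using ne \<kappa>(1) by (auto simp: inj_eq)
      qed (auto simp: when_def is_ideal_zero[OF i] is_ideal_scale[OF i] is_ideal_scale2[OF i])
      then show "?s z \<in> P" by (simp add: z)
    qed
    moreover have "(a, b) \<in> keys p \<times> keys q"
      using a(1) b(1) is_ideal_zero[OF i] by (auto simp: in_keys_iff)
    then have "lookup (p * q) (a + b) = lookup p a * lookup q b + sum ?s (keys p \<times> keys q - {(a, b)})"
      unfolding lookup_mult_finite by (subst sum.remove[of _ "(a, b)"]) auto
    ultimately have "lookup p a * lookup q b \<in> P"
      using pq(1) is_ideal_diff[OF i] by (metis (no_types, lifting) add_diff_cancel_right' mem_Collect_eq)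
    then show False using a b prime_ideal_mult[OF P] by blast
  qed
qed

lemma prime_ideal_zero_mpoly: "prime_ideal {0 :: ('v::finite, 'k::idom) mpoly}"
proof -
  have "{p :: ('v, 'k) mpoly. \<forall>a. lookup p a \<in> {0}} = {0}"
    by (auto intro: poly_mapping_eqI)
  then show ?thesis
    using prime_ideal_mpoly_coeffs[OF prime_ideal_zero_idom[where 'a = 'k], where 'v = 'v] by simp
qed

lemma mpoly_mult_eq_0_iff: "p * q = 0 \<longleftrightarrow> p = 0 \<or> q = (0 :: ('v::finite, 'k::idom) mpoly)"
  using prime_ideal_mult[OF prime_ideal_zero_mpoly, of p q] by simp


section \<open>Existence of prime ideals\<close>

text \<open>An ideal \<open>P\<close> that is maximal among those avoiding the powers of \<open>a\<close> is prime: if \<open>x\<close> and \<open>y\<close> are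
  outside of \<open>P\<close>, then \<open>P + (x)\<close> and \<open>P + (y)\<close> contain powers of \<open>a\<close>, whose product lies in \<open>P + (x y)\<close>;
  hence \<open>x y\<close> is outside of \<open>P\<close> as well.\<close>

lemma prime_avoiding_powers:
  fixes H :: "'a::comm_ring_1 set"
  assumes H: "is_ideal H" and a: "a \<notin> radical H"
  shows "\<exists>P. prime_ideal P \<and> H \<subseteq> P \<and> a \<notin> P"
proof -
  let ?A = "{K. is_ideal K \<and> H \<subseteq> K \<and> (\<forall>l. a ^ l \<notin> K)}"
  have "\<exists>U\<in>?A. \<forall>X\<in>C. X \<subseteq> U" if "subset.chain ?A C" for C
  proof (cases "C = {}")
    case True
    then show ?thesis using H a by (auto simp: radical_def)
  next
    case False
    have C: "\<And>X. X \<in> C \<Longrightarrow> X \<in> ?A" "\<And>X Y. X \<in> C \<Longrightarrow> Y \<in> C \<Longrightarrow> X \<subseteq> Y \<or> Y \<subseteq> X"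
      using that by (auto simp: subset_chain_def)
    have "is_ideal (\<Union>C)"
      unfolding ideal.subspace_def
    proof (intro conjI ballI allI)
      show "0 \<in> \<Union>C" using False C(1) is_ideal_zero by blast
      fix x assume x: "x \<in> \<Union>C"
      then show "c * x \<in> \<Union>C" for c using C(1) is_ideal_scale by blast
      fix y assume "y \<in> \<Union>C"
      with x obtain X where "X \<in> C" "x \<in> X" "y \<in> X" using C(2) by blast
      then show "x + y \<in> \<Union>C" using C(1) is_ideal_add by blast
    qed
    then have "\<Union>C \<in> ?A" using False C(1) by auto
    then show ?thesis by blast
  qed
  from subset_Zorn[of ?A, OF this] obtain P
    where P: "is_ideal P" "H \<subseteq> P" "\<And>l. a ^ l \<notin> P"
      and max: "\<And>X. is_ideal X \<Longrightarrow> H \<subseteq> X \<Longrightarrow> (\<And>l. a ^ l \<notin> X) \<Longrightarrow> P \<subseteq> X \<Longrightarrow> X = P"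
    by auto
  have *: "\<exists>l p c. p \<in> P \<and> a ^ l = p + c * x" if "x \<notin> P" for x
  proof (rule ccontr)
    assume no: "\<nexists>l p c. p \<in> P \<and> a ^ l = p + c * x"
    let ?X = "{p + c * x | p c. p \<in> P}"
    have X: "p + c * x \<in> ?X" if "p \<in> P" for p c using that by blast
    have "is_ideal ?X"
      unfolding ideal.subspace_def
    proof (intro conjI ballI allI)
      show "0 \<in> ?X" using X[OF is_ideal_zero[OF P(1)], of 0] by (simp only: add_0 mult_zero_left)
      fix u assume "u \<in> ?X"
      then obtain p c where u: "u = p + c * x" "p \<in> P"
        by (elim CollectE exE conjE) (rule that)
      have "d * u = d * p + (d * c) * x" for d
        by (simp only: u(1) distrib_left mult.assoc)
      then show "d * u \<in> ?X" for d
        using X[OF is_ideal_scale[OF P(1) u(2), of d], of "d * c"] by (simp only:)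
      fix v assume "v \<in> ?X"
      then obtain q d where v: "v = q + d * x" "q \<in> P"
        by (elim CollectE exE conjE) (rule that)
      have "u + v = (p + q) + (c + d) * x" by (simp only: u(1) v(1) distrib_right add_ac)
      then show "u + v \<in> ?X"
        using X[OF is_ideal_add[OF P(1) u(2) v(2)], of "c + d"] by (simp only:)
    qed
    moreover have "P \<subseteq> ?X"
    proof
      fix p assume "p \<in> P"
      from X[OF this, of 0] show "p \<in> ?X" by (simp only: add_0_right mult_zero_left)
    qed
    ultimately have "?X = P" using P(2) no by (intro max) blast+
    moreover have "x \<in> ?X" using X[OF is_ideal_zero[OF P(1)], of 1] by (simp only: add_0 mult_1)
    ultimately show False using that by blast
  qed
  have "prime_ideal P"
  proof (rule prime_idealI)
    show "1 \<notin> P" using P(3)[of 0] by simp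
    fix x y assume xy: "x * y \<in> P" "x \<notin> P"
    show "y \<in> P"
    proof (rule ccontr)
      assume "y \<notin> P"
      from *[OF this] *[OF xy(2)] obtain l p c l' p' c'
        where 1: "p \<in> P" "a ^ l = p + c * y" "p' \<in> P" "a ^ l' = p' + c' * x" by blast
      have "a ^ (l + l') = (p' + c' * x) * p + (c * y) * p' + (c * c') * (x * y)"
        by (simp only: power_add 1) (simp only: algebra_simps)
      also have "\<dots> \<in> P"
        by (intro is_ideal_add[OF P(1)] is_ideal_scale[OF P(1)] 1(1,3) xy(1))
      finally show False using P(3) by blast
    qed
  qed (fact P(1))
  moreover have "a \<notin> P" using P(3)[of 1] by simp
  ultimately show ?thesis using P(2) by blast
qed

lemma radical_eq_Inter_primes:
  assumes "is_ideal H"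
  shows "radical H = \<Inter>{P. prime_ideal P \<and> H \<subseteq> P}"
proof
  show "radical H \<subseteq> \<Inter>{P. prime_ideal P \<and> H \<subseteq> P}"
    using prime_ideal_power by (auto simp: radical_def)
  show "\<Inter>{P. prime_ideal P \<and> H \<subseteq> P} \<subseteq> radical H"
    using prime_avoiding_powers[OF assms] by blast
qed

text \<open>The intersection of a chain of primes is prime, so that Zorn's lemma applies downwards.\<close>

lemma minimal_prime_below:
  assumes Q: "prime_ideal Q" "H \<subseteq> Q"
  shows "\<exists>P\<in>minimal_primes H. P \<subseteq> Q"
proof -
  let ?A = "{- P | P. prime_ideal P \<and> H \<subseteq> P \<and> P \<subseteq> Q}"
  have "\<exists>U\<in>?A. \<forall>X\<in>C. X \<subseteq> U" if "subset.chain ?A C" for C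
  proof (cases "C = {}")
    case True
    have "- Q \<in> ?A" using Q by blast
    then show ?thesis using True by blast
  next
    case False
    have C: "\<And>X. X \<in> C \<Longrightarrow> prime_ideal (- X) \<and> H \<subseteq> - X \<and> - X \<subseteq> Q"
      "\<And>X Y. X \<in> C \<Longrightarrow> Y \<in> C \<Longrightarrow> X \<subseteq> Y \<or> Y \<subseteq> X"
      using that by (auto simp: subset_chain_def)
    have "prime_ideal (- \<Union>C)"
    proof (rule prime_idealI)
      have id: "is_ideal (- X)" if "X \<in> C" for X using C(1)[OF that] prime_ideal_is_ideal by blast
      show "is_ideal (- \<Union>C)"
        unfolding ideal.subspace_def
      proof (intro conjI ballI allI)
        show "0 \<in> - \<Union>C" using is_ideal_zero[OF id] by blast
        fix x assume x: "x \<in> - \<Union>C"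
        show "c * x \<in> - \<Union>C" for c using x is_ideal_scale[OF id, of _ x c] by blast
        fix y assume "y \<in> - \<Union>C"
        then show "x + y \<in> - \<Union>C" using x is_ideal_add[OF id, of _ x y] by blast
      qed
      show "1 \<notin> - \<Union>C" using False C(1) prime_ideal_one by fastforce
      fix x y assume xy: "x * y \<in> - \<Union>C" "x \<notin> - \<Union>C"
      then obtain X where X: "X \<in> C" "x \<in> X" by blast
      show "y \<in> - \<Union>C"
      proof
        assume "y \<in> \<Union>C"
        with X obtain Z where Z: "Z \<in> C" "x \<in> Z" "y \<in> Z" using C(2) by blast
        then have "x * y \<in> - Z" using xy by blast
        then show False using Z C(1)[OF Z(1)] prime_ideal_mult[of "- Z" x y] by blast
      qed
    qed
    moreover have "H \<subseteq> - \<Union>C" "- \<Union>C \<subseteq> Q" using False C(1) by blast+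
    ultimately have "\<Union>C \<in> ?A" by (intro CollectI exI[of _ "- \<Union>C"]) auto
    then show ?thesis by blast
  qed
  from subset_Zorn[of ?A, OF this] obtain P
    where P: "prime_ideal P" "H \<subseteq> P" "P \<subseteq> Q"
      and max: "\<And>R. prime_ideal R \<Longrightarrow> H \<subseteq> R \<Longrightarrow> R \<subseteq> Q \<Longrightarrow> - P \<subseteq> - R \<Longrightarrow> - R = - P"
    by (auto simp del: Compl_subset_Compl_iff compl_le_compl_iff) blast
  have "R = P" if "prime_ideal R" "H \<subseteq> R" "R \<subseteq> P" for R
    using max[of R] that P by blast
  then show ?thesis using P by (auto simp: minimal_primes_def)
qed

section \<open>Heights of primes in polynomial rings over a field\<close>

definition polys_in :: "'v set \<Rightarrow> ('v, 'k::comm_ring_1) mpoly set" where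
  "polys_in A = {p. \<forall>a\<in>keys p. keys a \<subseteq> A}"

lemma polys_in_single: "keys a \<subseteq> A \<Longrightarrow> single a x \<in> polys_in A"
  by (auto simp: polys_in_def)

lemma polys_in_zero: "0 \<in> polys_in A"
  by (auto simp: polys_in_def)

lemma polys_in_mconst: "mconst x \<in> polys_in A"
  by (auto simp: mconst_def intro!: polys_in_single)

lemma polys_in_mvar: "v \<in> A \<Longrightarrow> mvar v \<in> polys_in A"
  by (auto simp: mvar_def intro!: polys_in_single)

lemma polys_in_add: "p \<in> polys_in A \<Longrightarrow> q \<in> polys_in A \<Longrightarrow> p + q \<in> polys_in A"
  using Poly_Mapping.keys_add[of p q] by (auto simp: polys_in_def)

lemma polys_in_mult:
  assumes "p \<in> polys_in A" "q \<in> polys_in A"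
  shows "p * q \<in> polys_in A"
  unfolding polys_in_def
proof (intro CollectI ballI)
  fix c assume "c \<in> keys (p * q)"
  then obtain a b where "c = a + b" "a \<in> keys p" "b \<in> keys q"
    using keys_mult[of p q] by blast
  moreover from this have "keys a \<subseteq> A" "keys b \<subseteq> A"
    using assms by (auto simp: polys_in_def)
  ultimately show "keys c \<subseteq> A"
    using Poly_Mapping.keys_add[of a b] by blast
qed

lemma polys_in_sum: "(\<And>i. i \<in> B \<Longrightarrow> w i \<in> polys_in A) \<Longrightarrow> sum w B \<in> polys_in A"
  by (induction B rule: infinite_finite_induct) (auto intro: polys_in_zero polys_in_add)

lemma polys_in_mono: "A \<subseteq> B \<Longrightarrow> polys_in A \<subseteq> polys_in B"
  by (auto simp: polys_in_def)

lemma polys_in_UNIV: "polys_in UNIV = UNIV"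
  by (auto simp: polys_in_def)

lemma meval_cong_polys_in:
  assumes "p \<in> polys_in A" "\<And>v. v \<in> A \<Longrightarrow> g v = g' v"
  shows "meval c g p = meval c g' p"
  unfolding meval_def
proof (intro sum.cong refl arg_cong2[where f = "(*)"] prod.cong)
  fix a v assume "a \<in> keys p" "v \<in> keys a"
  then show "g v ^ lookup a v = g' v ^ lookup a v"
    using assms by (auto simp: polys_in_def subset_eq)
qed

lemma meval_closed:
  assumes c: "ring_map c" and p: "p \<in> polys_in A"
    and add: "\<And>u w. u \<in> R \<Longrightarrow> w \<in> R \<Longrightarrow> u + w \<in> R"
    and mult: "\<And>u w. u \<in> R \<Longrightarrow> w \<in> R \<Longrightarrow> u * w \<in> R"
    and const: "\<And>x. c x \<in> R" and var: "\<And>v. v \<in> A \<Longrightarrow> g v \<in> R"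
  shows "meval c g p \<in> R"
proof -
  interpret ring_map c by fact
  have 01: "0 \<in> R" "1 \<in> R" using const[of 0] const[of 1] hom_zero hom_one by simp_all
  have pow: "u ^ l \<in> R" if "u \<in> R" for u l
    using that by (induction l) (auto simp: 01 mult)
  have prod: "prod w B \<in> R" if "\<And>v. v \<in> B \<Longrightarrow> w v \<in> R" for w B
    using that by (induction B rule: infinite_finite_induct) (auto simp: 01 mult)
  have sum: "sum w B \<in> R" if "\<And>v. v \<in> B \<Longrightarrow> w v \<in> R" for w :: "_ \<Rightarrow> _" and B
    using that by (induction B rule: infinite_finite_induct) (auto simp: 01 add)
  show ?thesis
    unfolding meval_def using p
    by (intro sum mult const prod pow var) (auto simp: polys_in_def)
qed

lemma meval_in_ideal:
  assumes "is_ideal H" "\<And>a. c (lookup q a) \<in> H"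
  shows "meval c g q \<in> H"
  unfolding meval_def using assms by (intro is_ideal_sum is_ideal_scale2)

subsection \<open>Contracting to fewer variables and extending back\<close>

text \<open>The isomorphism of \<open>k[V]\<close> with the polynomial ring in \<open>V - B\<close> over \<open>k[B]\<close>. It is
  written as a map into a larger ring, with all of \<open>k[V]\<close> as coefficients and all of \<open>V\<close> as
  variables, so that \<open>B\<close> can vary without changing the type.\<close>

definition split_vars :: "'v set \<Rightarrow> ('v, 'k::comm_ring_1) mpoly \<Rightarrow> ('v, ('v, 'k) mpoly) mpoly" where
  "split_vars B = meval (\<lambda>x. mconst (mconst x)) (\<lambda>v. if v \<in> B then mconst (mvar v) else mvar v)"

lemma ring_map_mconst2: "ring_map (\<lambda>x. mconst (mconst x))"
  by (rule ring_map_comp[OF ring_map_mconst ring_map_mconst])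

lemma ring_map_split_vars: "ring_map (split_vars B)"
  unfolding split_vars_def by (rule ring_map_meval[OF ring_map_mconst2])

lemma lookup_split_vars_in:
  fixes p :: "('v, 'k::comm_ring_1) mpoly"
  assumes "p \<in> polys_in C"
  shows "lookup (split_vars B p) b \<in> polys_in (C \<inter> B)"
proof -
  let ?R = "{q :: ('v, ('v, 'k) mpoly) mpoly. \<forall>b. lookup q b \<in> polys_in (C \<inter> B)}"
  have "split_vars B p \<in> ?R"
    unfolding split_vars_def
  proof (rule meval_closed[OF ring_map_mconst2 assms])
    fix u w :: "('v, ('v, 'k) mpoly) mpoly" assume uw: "u \<in> ?R" "w \<in> ?R"
    then show "u + w \<in> ?R" by (auto simp: lookup_add intro: polys_in_add)
    show "u * w \<in> ?R" using uw
      by (auto simp: lookup_mult_finite when_def intro!: polys_in_sum polys_in_mult polys_in_zero)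
  next
    show "mconst (mconst x) \<in> ?R" for x
      unfolding mconst_def[of "mconst x"]
      by (auto simp: lookup_single when_def polys_in_zero polys_in_mconst)
  next
    fix v assume "v \<in> C"
    have "(1 :: ('v, 'k) mpoly) \<in> polys_in (C \<inter> B)" using polys_in_mconst[of 1] by (simp add: mconst_def)
    then have "mconst (mvar v) \<in> ?R" if "v \<in> B"
      unfolding mconst_def using \<open>v \<in> C\<close> that
      by (auto simp: lookup_single when_def polys_in_zero polys_in_mvar)
    moreover have "mvar v \<in> ?R"
      using \<open>(1 :: ('v, 'k) mpoly) \<in> polys_in (C \<inter> B)\<close>
      by (auto simp: mvar_def lookup_single when_def polys_in_zero)
    ultimately show "(if v \<in> B then mconst (mvar v) else mvar v) \<in> ?R" by simp
  qed
  then show ?thesis by blast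
qed

lemma split_vars_polys_in:
  assumes "p \<in> polys_in B"
  shows "split_vars B p = mconst p"
proof -
  have "split_vars B p = meval (\<lambda>x. mconst (mconst x)) (\<lambda>v. mconst (mvar v)) p"
    unfolding split_vars_def by (rule meval_cong_polys_in[OF assms]) simp
  also have "\<dots> = mconst p"
    by (rule mpoly_hom_eqI[OF ring_map_meval[OF ring_map_mconst2] ring_map_mconst])
      (simp_all add: meval_simps ring_map_mconst2)
  finally show ?thesis .
qed

lemma meval_split_vars: "meval (\<lambda>q. q) mvar (split_vars B p) = p"
  by (rule mpoly_hom_eqI[OF ring_map_comp[OF ring_map_meval ring_map_split_vars] ring_map_id])
    (simp_all add: split_vars_def meval_simps ring_map_mconst2 ring_map_id)

definition contract_extend :: "'v set \<Rightarrow> ('v, 'k::comm_ring_1) mpoly set \<Rightarrow> ('v, 'k) mpoly set" where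
  "contract_extend B Q = ideal_span (Q \<inter> polys_in B)"

text \<open>An element of the extended ideal is recognised by its coefficients in \<open>k[B]\<close>, which makes
  primality an instance of that for polynomials with coefficients in a prime.\<close>

lemma contract_extend_iff:
  fixes Q :: "('v::finite, 'k::comm_ring_1) mpoly set"
  assumes "prime_ideal Q"
  shows "contract_extend B Q = split_vars B -` {q. \<forall>b. lookup q b \<in> Q}"
proof
  let ?E = "split_vars B -` {q. \<forall>b. lookup q b \<in> Q}"
  note i = prime_ideal_is_ideal[OF assms]
  have "is_ideal ?E"
    by (rule is_ideal_vimage[OF ring_map_split_vars prime_ideal_is_ideal[OF prime_ideal_mpoly_coeffs[OF assms]]])
  moreover have "Q \<inter> polys_in B \<subseteq> ?E"
    by (auto simp: split_vars_polys_in mconst_def lookup_single when_def is_ideal_zero[OF i])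
  ultimately show "contract_extend B Q \<subseteq> ?E"
    unfolding contract_extend_def by (rule ideal_span_minimal)
  show "?E \<subseteq> contract_extend B Q"
  proof
    fix p assume "p \<in> ?E"
    then have "lookup (split_vars B p) b \<in> Q \<inter> polys_in B" for b
      using lookup_split_vars_in[of p UNIV B b] by (auto simp: polys_in_UNIV)
    then have "meval (\<lambda>q. q) mvar (split_vars B p) \<in> contract_extend B Q"
      unfolding contract_extend_def by (intro meval_in_ideal is_ideal_span ideal.span_base)
    then show "p \<in> contract_extend B Q" by (simp add: meval_split_vars)
  qed
qed

lemma prime_contract_extend:
  fixes Q :: "('v::finite, 'k::comm_ring_1) mpoly set"
  assumes "prime_ideal Q"
  shows "prime_ideal (contract_extend B Q)"
  unfolding contract_extend_iff[OF assms]
  by (rule prime_ideal_vimage[OF ring_map_split_vars prime_ideal_mpoly_coeffs[OF assms]])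

text \<open>The field generated by the residues of the variables has a transcendence basis among them, and
  for sets of variables, algebraic independence and maximality need only be tested on \<open>Q \<inter> k[A]\<close>.\<close>

definition transc_basis :: "'v set \<Rightarrow> ('v, 'k::comm_ring_1) mpoly set \<Rightarrow> bool" where
  "transc_basis A Q \<longleftrightarrow> Q \<inter> polys_in A \<subseteq> {0} \<and> (\<forall>v. v \<notin> A \<longrightarrow> \<not> Q \<inter> polys_in (insert v A) \<subseteq> {0})"

text \<open>Contracting \<open>Q\<close> to \<open>k[A]\<close> and adjoining the remaining variables one by one gives a chain of
  primes ending at \<open>Q\<close>. It is strict: a new variable \<open>v\<close> satisfies a relation over \<open>k[A]\<close> modulo \<open>Q\<close>, and if
  this relation were in the previous prime, its coefficients would lie in \<open>Q \<inter> k[A] = 0\<close>.\<close>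

lemma prime_height_ge:
  fixes Q :: "('v::finite, 'k::comm_ring_1) mpoly set"
  assumes Q: "prime_ideal Q" and A: "transc_basis A Q"
  shows "enat (card (- A)) \<le> prime_height Q"
proof -
  obtain e where e: "bij_betw e {0..<card (- A)} (- A)"
    using ex_bij_betw_nat_finite[of "- A"] by auto
  define B where "B i = A \<union> e ` {0..<i}" for i
  define C where "C i = contract_extend (B i) Q" for i
  have "C i \<subset> C (Suc i)" if i: "i < card (- A)" for i
  proof -
    have "e i \<notin> B i"
      using i e by (auto simp: B_def bij_betw_def inj_on_def) fastforce
    have "e i \<notin> A" using i e by (auto simp: bij_betw_def)
    then obtain F where F: "F \<in> Q" "F \<in> polys_in (insert (e i) A)" "F \<noteq> 0"
      using A by (auto simp: transc_basis_def)
    have "F \<notin> C i"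
    proof
      assume "F \<in> C i"
      then have "lookup (split_vars (B i) F) b \<in> Q" for b
        by (simp add: C_def contract_extend_iff[OF Q])
      moreover have "insert (e i) A \<inter> B i = A"
        using \<open>e i \<notin> B i\<close> by (auto simp: B_def)
      then have "lookup (split_vars (B i) F) b \<in> polys_in A" for b
        using lookup_split_vars_in[OF F(2), of "B i" b] by simp
      ultimately have "lookup (split_vars (B i) F) b = 0" for b
        using A unfolding transc_basis_def by blast
      then have "split_vars (B i) F = 0"
        by (intro poly_mapping_eqI) simp
      then show False using meval_split_vars[of "B i" F] F(3) by (simp add: meval_zero)
    qed
    moreover have "F \<in> C (Suc i)"
      unfolding C_def contract_extend_def
      using F(1,2) polys_in_mono[of "insert (e i) A" "B (Suc i)"]
      by (intro ideal.span_base) (auto simp: B_def)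
    moreover have "B i \<subseteq> B (Suc i)" by (force simp: B_def)
    then have "C i \<subseteq> C (Suc i)"
      unfolding C_def contract_extend_def using polys_in_mono by (blast intro!: ideal.span_mono)
    ultimately show ?thesis by blast
  qed
  moreover have "B (card (- A)) = UNIV"
    using e by (auto simp: B_def bij_betw_def)
  then have "C (card (- A)) = Q"
    using ideal.span_eq_iff[of Q] prime_ideal_is_ideal[OF Q]
    by (simp add: C_def contract_extend_def polys_in_UNIV)
  moreover have "prime_ideal (C i)" for i
    unfolding C_def by (rule prime_contract_extend[OF Q])
  ultimately show ?thesis
    unfolding prime_height_def by (intro Sup_upper) blast
qed

lemma ex_transc_basis:
  fixes Q :: "('v::finite, 'k::field) mpoly set"
  assumes Q: "prime_ideal Q"
  shows "\<exists>A. transc_basis A Q"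
proof -
  let ?I = "{A :: 'v set. Q \<inter> polys_in A \<subseteq> {0}}"
  have "{} \<in> ?I"
  proof (clarsimp)
    fix p :: "('v, 'k) mpoly" assume p: "p \<in> Q" "p \<in> polys_in {}"
    then have "keys p \<subseteq> {0}" by (auto simp: polys_in_def)
    then have "p = mconst (lookup p 0)"
      by (intro poly_mapping_eqI) (auto simp: mconst_def lookup_single when_def in_keys_iff)
    then obtain x where x: "p = mconst x" by blast
    show "p = 0"
    proof (rule ccontr)
      assume "p \<noteq> 0"
      then have "x \<noteq> 0" using x by (auto simp: mconst_def)
      then have "mconst (inverse x) * p = 1"
        by (simp add: x mconst_def mult_single)
      then show False
        using is_ideal_scale[OF prime_ideal_is_ideal[OF Q] p(1), of "mconst (inverse x)"] prime_ideal_one[OF Q]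
        by simp
    qed
  qed
  then have "\<exists>A\<in>?I. \<forall>B\<in>?I. A \<subseteq> B \<longrightarrow> A = B"
    using finite_has_maximal[of ?I] by auto
  then obtain A where A: "A \<in> ?I" "\<And>B. B \<in> ?I \<Longrightarrow> A \<subseteq> B \<Longrightarrow> A = B" by auto
  have "insert v A \<notin> ?I" if "v \<notin> A" for v
    using A(2)[of "insert v A"] that by blast
  then have "transc_basis A Q" using A(1) by (auto simp: transc_basis_def)
  then show ?thesis ..
qed

subsection \<open>Algebraically independent families modulo a prime\<close>

definition alg_indep_mod ::
    "nat \<Rightarrow> (nat \<Rightarrow> ('v, 'k::comm_ring_1) mpoly) \<Rightarrow> ('v, 'k) mpoly set \<Rightarrow> bool" where
  "alg_indep_mod d h Q \<longleftrightarrow> (\<forall>F\<in>polys_in {..<d}. meval mconst h F \<in> Q \<longrightarrow> F = 0)"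

lemma keys_sum_ball:
  assumes "\<And>i. i \<in> B \<Longrightarrow> \<forall>a\<in>keys (w i). P a"
  shows "\<forall>a\<in>keys (sum w B). P a"
  using assms
proof (induction B rule: infinite_finite_induct)
  case (insert i B)
  then show ?case using Poly_Mapping.keys_add[of "w i" "sum w B"] by auto
qed simp_all

lemma split_off_variable:
  fixes F :: "(nat, 'k::comm_ring_1) mpoly"
  assumes F: "F \<in> polys_in {..<Suc d}" and n: "\<forall>a\<in>keys F. lookup a d < Suc n"
  obtains F0 F1 where "F = F0 + mvar d * F1" "F0 \<in> polys_in {..<d}" "F1 \<in> polys_in {..<Suc d}"
    "\<forall>a\<in>keys F1. lookup a d < n"
proof
  let ?K0 = "{a \<in> keys F. lookup a d = 0}" and ?K1 = "{a \<in> keys F. lookup a d \<noteq> 0}"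
  let ?F0 = "\<Sum>a\<in>?K0. single a (lookup F a)"
  let ?F1 = "\<Sum>a\<in>?K1. single (a - single d 1) (lookup F a)"
  have "mvar d * single (a - single d 1) x = (single a x :: (nat, 'k) mpoly)" if "a \<in> ?K1" for a x
  proof -
    have "single d 1 + (a - single d 1) = a"
      using that by (intro poly_mapping_eqI) (auto simp: lookup_add lookup_minus lookup_single when_def)
    then show ?thesis by (simp add: mvar_def mult_single)
  qed
  then have "mvar d * ?F1 = (\<Sum>a\<in>?K1. single a (lookup F a))"
    by (simp add: sum_distrib_left)
  moreover have "F = (\<Sum>a\<in>?K0 \<union> ?K1. single a (lookup F a))"
  proof -
    have "?K0 \<union> ?K1 = keys F" by auto
    then show ?thesis using mpoly_sum_single[of F] by simp
  qed
  then have "F = ?F0 + (\<Sum>a\<in>?K1. single a (lookup F a))"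
    by (subst (asm) sum.union_disjoint) auto
  ultimately show "F = ?F0 + mvar d * ?F1" by simp
  show "?F0 \<in> polys_in {..<d}"
  proof (rule polys_in_sum, rule polys_in_single)
    fix a assume "a \<in> ?K0"
    then have "keys a \<subseteq> {..<Suc d}" "d \<notin> keys a" using F by (auto simp: polys_in_def in_keys_iff)
    then show "keys a \<subseteq> {..<d}" by (auto simp: less_Suc_eq)
  qed
  show "?F1 \<in> polys_in {..<Suc d}"
  proof (rule polys_in_sum, rule polys_in_single)
    fix a assume "a \<in> ?K1"
    then have "keys a \<subseteq> {..<Suc d}" using F by (auto simp: polys_in_def)
    moreover have "keys (a - single d 1) \<subseteq> keys a" by (auto simp: in_keys_iff lookup_minus)
    ultimately show "keys (a - single d 1) \<subseteq> {..<Suc d}" by blast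
  qed
  show "\<forall>a\<in>keys ?F1. lookup a d < n"
  proof (rule keys_sum_ball)
    fix a assume "a \<in> ?K1"
    then have "lookup a d \<noteq> 0" "lookup a d < Suc n" using n by auto
    then have "lookup (a - single d 1) d < n" by (simp add: lookup_minus)
    then show "\<forall>b\<in>keys (single (a - single d 1) (lookup F a)). lookup b d < n" by auto
  qed
qed

text \<open>Passing from \<open>Q'\<close> to a smaller prime \<open>Q\<close>, a family gains any element of \<open>Q' - Q\<close>: in a relation
  modulo \<open>Q\<close>, the part without this element is a relation of the family modulo \<open>Q'\<close>, hence zero,
  and as \<open>Q\<close> is prime, the new element can be cancelled from the rest.\<close>

lemma alg_indep_mod_Suc:
  fixes Q Q' :: "('v, 'k::comm_ring_1) mpoly set"
  assumes Q: "prime_ideal Q" and Q': "is_ideal Q'" "Q \<subseteq> Q'"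
    and h: "h d \<in> Q'" "h d \<notin> Q" and ind: "alg_indep_mod d h Q'"
  shows "alg_indep_mod (Suc d) h Q"
proof -
  interpret ev: ring_map "meval mconst h" by (rule ring_map_meval[OF ring_map_mconst])
  have "F = 0" if "F \<in> polys_in {..<Suc d}" "\<forall>a\<in>keys F. lookup a d < n" "meval mconst h F \<in> Q" for F n
    using that
  proof (induction n arbitrary: F)
    case 0
    then have "keys F = {}" by auto
    then show ?case by simp
  next
    case (Suc n)
    obtain F0 F1 where F: "F = F0 + mvar d * F1" "F0 \<in> polys_in {..<d}" "F1 \<in> polys_in {..<Suc d}"
      "\<forall>a\<in>keys F1. lookup a d < n"
      using split_off_variable[OF Suc.prems(1,2)] by metis
    have ev: "meval mconst h F = meval mconst h F0 + h d * meval mconst h F1"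
      by (simp only: F(1) ev.hom_add ev.hom_mult meval_mvar_hom[OF ring_map_mconst])
    have "meval mconst h F - h d * meval mconst h F1 \<in> Q'"
      using Suc.prems(3) Q'(2) h(1) by (intro is_ideal_diff[OF Q'(1)] is_ideal_scale2[OF Q'(1)]) auto
    then have "meval mconst h F0 \<in> Q'" by (simp add: ev)
    then have "F0 = 0" using ind F(2) by (auto simp: alg_indep_mod_def)
    then have "meval mconst h F1 \<in> Q"
      using Suc.prems(3) h(2) prime_ideal_mult[OF Q] by (simp add: ev meval_zero)
    then have "F1 = 0" by (rule Suc.IH[OF F(3,4)])
    then show ?case using F(1) \<open>F0 = 0\<close> by simp
  qed
  moreover have "\<exists>n. \<forall>a\<in>keys F. lookup a d < n" for F :: "(nat, 'k) mpoly"
    by (rule exI[of _ "Suc (\<Sum>a\<in>keys F. lookup a d)"])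
      (auto simp: less_Suc_eq_le intro!: member_le_sum)
  ultimately show ?thesis unfolding alg_indep_mod_def by blast
qed

lemma alg_indep_mod_cong:
  "(\<And>i. i < d \<Longrightarrow> h i = h' i) \<Longrightarrow> alg_indep_mod d h Q \<longleftrightarrow> alg_indep_mod d h' Q"
  unfolding alg_indep_mod_def
  using meval_cong_polys_in[of _ "{..<d}" h h' mconst] by auto

lemma alg_indep_mod_vars:
  fixes Q :: "('v::finite, 'k::comm_ring_1) mpoly set"
  assumes "Q \<inter> polys_in A \<subseteq> {0}"
  shows "\<exists>h. alg_indep_mod (card A) h Q"
proof -
  obtain e where e: "bij_betw e {0..<card A} A"
    using ex_bij_betw_nat_finite[of A] by auto
  define e' where "e' = inv_into {0..<card A} e"
  have e': "e' (e i) = i" if "i < card A" for i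
    using e that by (auto simp: e'_def bij_betw_def)
  have "F = 0" if F: "F \<in> polys_in {..<card A}" and ev: "meval mconst (\<lambda>i. mvar (e i)) F \<in> Q" for F
  proof -
    let ?p = "meval mconst (\<lambda>i. mvar (e i)) F :: ('v, 'k) mpoly"
    have "?p \<in> polys_in A"
      using e by (intro meval_closed[OF ring_map_mconst F] polys_in_add polys_in_mult polys_in_mconst
          polys_in_mvar) (auto simp: bij_betw_def)
    with ev assms have "?p = 0" by auto
    then have "0 = meval mconst (\<lambda>v. mvar (e' v)) ?p" by (simp add: meval_zero)
    also have "\<dots> = meval mconst (\<lambda>i. mvar (e' (e i))) F"
      by (rule mpoly_hom_eqI[OF ring_map_comp[OF ring_map_meval ring_map_meval] ring_map_meval])
        (simp_all add: ring_map_mconst meval_simps)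
    also have "\<dots> = meval mconst mvar F"
      by (rule meval_cong_polys_in[OF F]) (simp add: e')
    also have "\<dots> = F"
      by (rule mpoly_hom_eqI[OF ring_map_meval ring_map_id]) (simp_all add: ring_map_mconst meval_simps)
    finally show ?thesis by simp
  qed
  then have "alg_indep_mod (card A) (\<lambda>i. mvar (e i)) Q" by (simp add: alg_indep_mod_def)
  then show ?thesis by blast
qed

definition bounded_exps :: "nat \<Rightarrow> ('v \<Rightarrow>\<^sub>0 nat) set" where
  "bounded_exps K = {a. \<forall>v. lookup a v \<le> K}"

lemma bounded_exps_card:
  "finite (bounded_exps K :: ('v::finite \<Rightarrow>\<^sub>0 nat) set) \<and>
   card (bounded_exps K :: ('v \<Rightarrow>\<^sub>0 nat) set) \<le> (K + 1) ^ CARD('v)"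
proof -
  let ?B = "bounded_exps K :: ('v \<Rightarrow>\<^sub>0 nat) set" and ?P = "PiE UNIV (\<lambda>_ :: 'v. {..K})"
  have "inj_on lookup ?B" by (auto intro!: inj_onI poly_mapping_eqI)
  moreover have "lookup ` ?B \<subseteq> ?P" by (auto simp: bounded_exps_def)
  moreover have "finite ?P" by (rule finite_PiE) auto
  moreover have "card ?P = (K + 1) ^ CARD('v)" by (simp add: card_PiE)
  ultimately show ?thesis
    using card_inj_on_le[of lookup ?B ?P] inj_on_finite[of lookup ?B ?P] by auto
qed

lemma keys_bounded_mult:
  assumes "keys p \<subseteq> bounded_exps K" "keys q \<subseteq> bounded_exps L"
  shows "keys (p * q) \<subseteq> bounded_exps (K + L)"
proof
  fix c assume "c \<in> keys (p * q)"
  then obtain a b where "c = a + b" "a \<in> keys p" "b \<in> keys q"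
    using keys_mult[of p q] by blast
  moreover from this have "a \<in> bounded_exps K" "b \<in> bounded_exps L" using assms by auto
  ultimately show "c \<in> bounded_exps (K + L)"
    by (auto simp: bounded_exps_def lookup_add intro: add_mono)
qed

lemma keys_bounded_power:
  fixes p :: "('v, 'k::comm_ring_1) mpoly"
  assumes "keys p \<subseteq> bounded_exps D"
  shows "keys (p ^ l) \<subseteq> bounded_exps (l * D)"
proof (induction l)
  case 0
  show ?case by (auto simp: bounded_exps_def)
next
  case (Suc l)
  then show ?case using keys_bounded_mult[OF assms Suc.IH] by simp
qed

lemma keys_bounded_prod:
  fixes w :: "nat \<Rightarrow> ('v, 'k::comm_ring_1) mpoly"
  assumes "\<And>i. i < d \<Longrightarrow> keys (w i) \<subseteq> bounded_exps L"
  shows "keys (prod w {..<d}) \<subseteq> bounded_exps (d * L)"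
  using assms
proof (induction d)
  case 0
  show ?case by (auto simp: bounded_exps_def)
next
  case (Suc d)
  have "keys (prod w {..<d} * w d) \<subseteq> bounded_exps (d * L + L)"
    using Suc by (intro keys_bounded_mult) auto
  then show ?case by (simp add: add.commute mult.commute)
qed

text \<open>More polynomials than variables are algebraically dependent: the number of monomials in
  them with exponents less than \<open>N\<close> grows faster with \<open>N\<close> than the dimension of the space of polynomials
  in which these monomials lie.\<close>

lemma alg_indep_card_le:
  fixes h :: "nat \<Rightarrow> ('v::finite, 'k::field) mpoly"
  assumes ind: "alg_indep_mod d h {0}"
  shows "d \<le> CARD('v)"
proof (rule ccontr)
  assume d: "\<not> d \<le> CARD('v)"
  interpret ev: ring_map "meval mconst h" by (rule ring_map_meval[OF ring_map_mconst])
  interpret vs: vector_space "\<lambda>c p. mconst c * p :: ('v, 'k) mpoly"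
    by unfold_locales
      (simp_all only: ring_map.hom_add[OF ring_map_mconst] ring_map.hom_mult[OF ring_map_mconst]
        ring_map.hom_one[OF ring_map_mconst] distrib_left distrib_right mult.assoc mult_1)
  define D where "D = (\<Sum>i<d. \<Sum>a\<in>keys (h i). \<Sum>v\<in>UNIV. lookup a v)"
  have D: "keys (h i) \<subseteq> bounded_exps D" if "i < d" for i
  proof
    fix a assume a: "a \<in> keys (h i)"
    have "lookup a v \<le> D" for v
    proof -
      have "lookup a v \<le> (\<Sum>v\<in>UNIV. lookup a v)" by (rule member_le_sum) auto
      also have "\<dots> \<le> (\<Sum>a\<in>keys (h i). \<Sum>v\<in>UNIV. lookup a v)" using a by (intro member_le_sum) auto
      also have "\<dots> \<le> D" unfolding D_def using that by (intro member_le_sum) auto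
      finally show ?thesis .
    qed
    then show "a \<in> bounded_exps D" by (simp add: bounded_exps_def)
  qed
  \<comment> \<open>The monomials \<open>m s\<close> below have degree at most \<open>d N D\<close> in each variable; this \<open>N\<close> makes their
    number \<open>N ^ d\<close> exceed the number of monomials of such degrees.\<close>
  define N where "N = Suc ((d * D + 1) ^ CARD('v))"
  have large: "(d * (N * D) + 1) ^ CARD('v) < N ^ d"
  proof -
    have "1 \<le> N" by (simp add: N_def)
    then have "d * (N * D) + 1 \<le> N * (d * D + 1)" by (simp add: distrib_left mult.left_commute)
    then have "(d * (N * D) + 1) ^ CARD('v) \<le> N ^ CARD('v) * (d * D + 1) ^ CARD('v)"
      unfolding power_mult_distrib[symmetric] by (rule power_mono) simp
    also have "\<dots> < N ^ CARD('v) * N" by (intro mult_strict_left_mono) (auto simp: N_def)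
    also have "\<dots> = N ^ Suc (CARD('v))" by simp
    also have "\<dots> \<le> N ^ d" using d by (intro power_increasing) (auto simp: N_def)
    finally show ?thesis .
  qed
  let ?S = "PiE {..<d} (\<lambda>_. {..<N})"
  define mon :: "(nat \<Rightarrow> nat) \<Rightarrow> (nat \<Rightarrow>\<^sub>0 nat)" where "mon s = (\<Sum>i<d. single i (s i))" for s
  have lookup_mon: "lookup (mon s) i = (if i < d then s i else 0)" for s i
    by (simp add: mon_def lookup_sum lookup_single when_def)
  have keys_mon: "keys (mon s) \<subseteq> {..<d}" for s
    by (auto simp: in_keys_iff lookup_mon split: if_splits)
  have inj_mon: "s = s'" if "s \<in> ?S" "s' \<in> ?S" "mon s = mon s'" for s s'
  proof (rule PiE_ext[OF that(1,2)])
    fix i assume "i \<in> {..<d}"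
    then show "s i = s' i" using arg_cong[OF that(3), of "\<lambda>a. lookup a i"] by (simp add: lookup_mon)
  qed
  define m where "m s = (\<Prod>i<d. h i ^ s i)" for s
  have ev_mon: "meval mconst h (single (mon s) x) = mconst x * m s" for s x
  proof -
    have "(\<Prod>i\<in>keys (mon s). h i ^ lookup (mon s) i) = (\<Prod>i<d. h i ^ lookup (mon s) i)"
      using keys_mon by (intro prod.mono_neutral_left) (auto simp: in_keys_iff)
    also have "\<dots> = m s" unfolding m_def by (intro prod.cong) (auto simp: lookup_mon)
    finally show ?thesis by (simp add: meval_single ring_map.hom_zero[OF ring_map_mconst])
  qed
  have relation: "F = 0" if "F = (\<Sum>s\<in>S. single (mon s) (x s))" "meval mconst h F = 0" for F S x
  proof -
    have "F \<in> polys_in {..<d}"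
      unfolding that(1) by (intro polys_in_sum polys_in_single keys_mon)
    then show ?thesis using ind that(2) by (auto simp: alg_indep_mod_def)
  qed
  have coeff: "lookup (\<Sum>s\<in>S. single (mon s) (x s :: 'k)) (mon s) = x s"
    if "finite S" "S \<subseteq> ?S" "s \<in> S" for S s x
  proof -
    have "mon t = mon s \<longleftrightarrow> t = s" if "t \<in> S" for t
      using inj_mon[of t s] that \<open>S \<subseteq> ?S\<close> \<open>s \<in> S\<close> by blast
    then have "lookup (\<Sum>s\<in>S. single (mon s) (x s)) (mon s) = (\<Sum>t\<in>S. if t = s then x t else 0)"
      by (simp add: lookup_sum lookup_single when_def)
    then show ?thesis using that by simp
  qed
  have fin: "finite ?S" by (rule finite_PiE) auto
  have inj: "inj_on m ?S"
  proof (rule inj_onI, rule ccontr)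
    fix s t assume st: "s \<in> ?S" "t \<in> ?S" "m s = m t" "s \<noteq> t"
    let ?x = "\<lambda>u. if u = s then 1 else - 1 :: 'k"
    let ?F = "\<Sum>u\<in>{s, t}. single (mon u) (?x u)"
    have "meval mconst h ?F = 0"
      using st by (simp add: ev.hom_add ev_mon ring_map.hom_one[OF ring_map_mconst]
          ring_map.hom_uminus[OF ring_map_mconst])
    then have "?F = 0" by (rule relation[OF refl])
    moreover have "lookup ?F (mon s) = ?x s" using st by (intro coeff) auto
    ultimately show False by simp
  qed
  have m_span: "m ` ?S \<subseteq> vs.span ((\<lambda>a. single a 1) ` bounded_exps (d * (N * D)))"
  proof
    fix p assume "p \<in> m ` ?S"
    then obtain s where s: "s \<in> ?S" "p = m s" by blast
    have "keys (h i ^ s i) \<subseteq> bounded_exps (N * D)" if "i < d" for i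
    proof -
      have "s i \<le> N" using s(1) that by (auto simp: PiE_iff less_imp_le)
      then have "bounded_exps (s i * D) \<subseteq> (bounded_exps (N * D) :: ('v \<Rightarrow>\<^sub>0 nat) set)"
        by (auto simp: bounded_exps_def intro: order_trans mult_right_mono)
      then show ?thesis using keys_bounded_power[OF D[OF that], of "s i"] by blast
    qed
    then have k: "keys p \<subseteq> bounded_exps (d * (N * D))"
      unfolding s(2) m_def by (rule keys_bounded_prod)
    have "single a (lookup p a) = mconst (lookup p a) * single a 1" for a
      by (simp add: mconst_def mult_single)
    then have "p = (\<Sum>a\<in>keys p. mconst (lookup p a) * single a 1)"
      using mpoly_sum_single[of p] by simp
    also have "\<dots> \<in> vs.span ((\<lambda>a. single a 1) ` bounded_exps (d * (N * D)))"
      using k by (intro vs.span_sum vs.span_scale vs.span_base) auto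
    finally show "p \<in> vs.span ((\<lambda>a. single a 1) ` bounded_exps (d * (N * D)))" .
  qed
  have "vs.independent (m ` ?S)"
  proof (rule ccontr)
    assume "\<not> vs.independent (m ` ?S)"
    then obtain u p where u: "(\<Sum>p\<in>m ` ?S. mconst (u p) * p) = 0" "p \<in> m ` ?S" "u p \<noteq> 0"
      using vs.dependent_finite[of "m ` ?S"] fin by auto
    from u(2) obtain s where s: "s \<in> ?S" "p = m s" by blast
    let ?F = "\<Sum>s\<in>?S. single (mon s) (u (m s))"
    have "meval mconst h ?F = (\<Sum>p\<in>m ` ?S. mconst (u p) * p)"
      by (simp add: ev.hom_sum ev_mon sum.reindex[OF inj])
    then have "?F = 0" using u(1) by (intro relation[OF refl]) simp
    moreover have "lookup ?F (mon s) = u (m s)" using s fin by (intro coeff) auto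
    ultimately show False using u(3) s(2) by simp
  qed
  then have "card (m ` ?S) \<le> card ((\<lambda>a. single a (1 :: 'k)) ` (bounded_exps (d * (N * D)) :: ('v \<Rightarrow>\<^sub>0 nat) set))"
    using vs.independent_span_bound[OF _ _ m_span] bounded_exps_card by blast
  also have "\<dots> \<le> card (bounded_exps (d * (N * D)) :: ('v \<Rightarrow>\<^sub>0 nat) set)"
    using bounded_exps_card by (intro card_image_le) blast
  also have "\<dots> \<le> (d * (N * D) + 1) ^ CARD('v)" using bounded_exps_card by blast
  also have "\<dots> < N ^ d" by (rule large)
  also have "N ^ d = card (m ` ?S)" by (simp add: card_image[OF inj] card_PiE)
  finally show False by simp
qed

text \<open>Descending from \<open>Q\<close> along a chain of primes of length \<open>l\<close>, the independent family \<open>A\<close> grows to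
  \<open>card A + l\<close> members.\<close>

lemma prime_height_le:
  fixes Q :: "('v::finite, 'k::field) mpoly set"
  assumes A: "Q \<inter> polys_in A \<subseteq> {0}"
  shows "prime_height Q \<le> enat (card (- A))"
  unfolding prime_height_def
proof (rule Sup_least, clarify)
  fix l and C :: "nat \<Rightarrow> ('v, 'k) mpoly set"
  assume prime: "\<forall>i\<le>l. prime_ideal (C i)" and strict: "\<forall>i<l. C i \<subset> C (Suc i)" and Q: "Q = C l"
  have "\<exists>h. alg_indep_mod (card A + j) h (C (l - j))" if "j \<le> l" for j
    using that
  proof (induction j)
    case 0
    show ?case using alg_indep_mod_vars[OF A] by (simp add: Q)
  next
    case (Suc j)
    then obtain h where h: "alg_indep_mod (card A + j) h (C (l - j))" by auto
    have sub: "C (l - Suc j) \<subset> C (l - j)"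
      using strict[rule_format, of "l - Suc j"] Suc.prems by (simp add: Suc_diff_Suc)
    then obtain x where x: "x \<in> C (l - j)" "x \<notin> C (l - Suc j)" by blast
    let ?h = "h(card A + j := x)"
    have "alg_indep_mod (card A + j) ?h (C (l - j))"
      using h alg_indep_mod_cong[of "card A + j" ?h h] by simp
    then have "alg_indep_mod (Suc (card A + j)) ?h (C (l - Suc j))"
      using prime x sub by (intro alg_indep_mod_Suc[of _ "C (l - j)"] prime_ideal_is_ideal) auto
    then show ?case by auto
  qed
  from this[of l] obtain h where "alg_indep_mod (card A + l) h (C 0)" by auto
  moreover have "0 \<in> C 0" using prime is_ideal_zero prime_ideal_is_ideal by blast
  ultimately have "alg_indep_mod (card A + l) h {0}" by (auto simp: alg_indep_mod_def)
  then have "card A + l \<le> CARD('v)" by (rule alg_indep_card_le)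
  then show "enat l \<le> enat (card (- A))" by (simp add: Compl_eq_Diff_UNIV card_Diff_subset)
qed

lemma prime_height_eq:
  fixes Q :: "('v::finite, 'k::field) mpoly set"
  assumes "prime_ideal Q" and "transc_basis A Q"
  shows "prime_height Q = enat (card (- A))"
  using prime_height_ge[OF assms] prime_height_le[of Q A] assms(2)
  by (simp add: transc_basis_def)

section \<open>The primes \<open>plus_y \<pp>\<close> and the Rees-like prime\<close>

instance tvar :: (finite, finite) finite
proof
  have "v \<in> range XV \<union> range YV \<union> {ZV}" for v :: "('a, 'b) tvar"
    by (cases v) auto
  then have "(UNIV :: ('a, 'b) tvar set) \<subseteq> range XV \<union> range YV \<union> {ZV}" by blast
  then show "finite (UNIV :: ('a, 'b) tvar set)" by (rule finite_subset) simp
qed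

lemma ring_map_map_poly:
  assumes "ring_map h"
  shows "ring_map (map_poly h)"
proof -
  interpret ring_map h by fact
  show ?thesis
    by unfold_locales
      (auto intro!: poly_eqI simp: coeff_map_poly hom_zero hom_one hom_add coeff_mult hom_sum hom_mult)
qed

lemma ring_map_poly: "ring_map (\<lambda>u. poly u z)"
  by unfold_locales simp_all

lemma ring_map_pcompose: "ring_map (\<lambda>u. pcompose u w)"
  by unfold_locales (simp_all add: pcompose_1 pcompose_add pcompose_mult)

lemma mpoly_hom_eq_on:
  assumes g: "ring_map g" and h: "ring_map h" and const: "\<And>x. g (mconst x) = h (mconst x)"
    and var: "\<And>v. v \<in> A \<Longrightarrow> g (mvar v) = h (mvar v)" and p: "p \<in> polys_in A"
  shows "g p = h p"
proof -
  have "meval mconst mvar p \<in> {p. g p = h p}"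
    by (rule meval_closed[OF ring_map_mconst p])
      (simp_all add: const var ring_map.hom_add[OF g] ring_map.hom_add[OF h]
        ring_map.hom_mult[OF g] ring_map.hom_mult[OF h])
  moreover have "meval mconst mvar p = p"
    by (rule mpoly_hom_eqI[OF ring_map_meval[OF ring_map_mconst] ring_map_id])
      (simp_all add: ring_map_mconst meval_simps)
  ultimately show ?thesis by simp
qed

lemma ring_map_S_to_T: "ring_map S_to_T"
  unfolding S_to_T_def by (rule ring_map_meval[OF ring_map_mconst])

lemma S_to_T_mconst: "S_to_T (mconst x) = mconst x"
  and S_to_T_mvar: "S_to_T (mvar i) = mvar (XV i)"
  by (simp_all add: S_to_T_def meval_simps ring_map_mconst)

lemma ring_map_const_poly: "ring_map (\<lambda>c. [:mconst c:])"
  by (rule ring_map_comp[OF ring_map_pCons ring_map_mconst])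

lemma ring_map_rees_like_map: "ring_map (rees_like_map f)"
  unfolding rees_like_map_def by (rule ring_map_meval[OF ring_map_const_poly])

text \<open>With \<open>S[z]\<close> realised as \<open>S poly\<close>, \<open>mod_y\<close> is the reduction \<open>T \<rightarrow> T/(y) = S[z]\<close> and
  \<open>Sz_to_T\<close> the inclusion \<open>S[z] \<rightarrow> T\<close>.\<close>

definition mod_y :: "(('n, 'm) tvar, 'k::comm_ring_1) mpoly \<Rightarrow> ('n, 'k) mpoly poly" where
  "mod_y = meval (\<lambda>c. [:mconst c:])
     (\<lambda>v. case v of XV i \<Rightarrow> [:mvar i:] | YV j \<Rightarrow> 0 | ZV \<Rightarrow> [:0, 1:])"

definition Sz_to_T :: "('n, 'k::comm_ring_1) mpoly poly \<Rightarrow> (('n, 'm) tvar, 'k) mpoly" where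
  "Sz_to_T u = poly (map_poly S_to_T u) (mvar ZV)"

lemma ring_map_mod_y: "ring_map mod_y"
  unfolding mod_y_def by (rule ring_map_meval[OF ring_map_const_poly])

lemma ring_map_Sz_to_T: "ring_map Sz_to_T"
  unfolding Sz_to_T_def[abs_def]
  by (rule ring_map_comp[OF ring_map_poly ring_map_map_poly[OF ring_map_S_to_T]])

lemma mod_y_simps:
  "mod_y (mconst x) = [:mconst x:]" "mod_y (mvar (XV i)) = [:mvar i:]"
  "mod_y (mvar (YV j)) = 0" "mod_y (mvar ZV) = [:0, 1:]"
  by (simp_all add: mod_y_def meval_simps ring_map_const_poly)

lemma mod_y_S_to_T: "mod_y (S_to_T a) = [:a:]"
  by (rule mpoly_hom_eqI[OF ring_map_comp[OF ring_map_mod_y ring_map_S_to_T] ring_map_pCons])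
    (simp_all add: S_to_T_mconst S_to_T_mvar mod_y_simps)

lemma rees_like_map_S_to_T: "rees_like_map f (S_to_T a) = [:a:]"
  by (rule mpoly_hom_eqI[OF ring_map_comp[OF ring_map_rees_like_map ring_map_S_to_T] ring_map_pCons])
    (simp_all add: S_to_T_mconst S_to_T_mvar rees_like_map_simps)

lemma Sz_to_T_pCons: "Sz_to_T (pCons a u) = S_to_T a + mvar ZV * Sz_to_T u"
  by (simp add: Sz_to_T_def map_poly_pCons ring_map.hom_zero[OF ring_map_S_to_T])

lemma Sz_to_T_0: "Sz_to_T 0 = 0"
  by (simp add: Sz_to_T_def)

lemma rees_like_map_Sz_to_T: "rees_like_map f (Sz_to_T u) = pcompose u [:0, 0, 1:]"
proof (induction u)
  case 0
  show ?case by (simp add: Sz_to_T_0 ring_map.hom_zero[OF ring_map_rees_like_map])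
next
  case (pCons a u)
  then show ?case
    by (simp add: Sz_to_T_pCons rees_like_map_simps rees_like_map_S_to_T pcompose_pCons)
qed

lemma Sz_to_T_mod_y:
  assumes "p \<in> polys_in (range XV \<union> {ZV})"
  shows "Sz_to_T (mod_y p) = p"
  using assms
  by (rule mpoly_hom_eq_on[OF ring_map_comp[OF ring_map_Sz_to_T ring_map_mod_y] ring_map_id, rotated -1])
    (auto simp: mod_y_simps Sz_to_T_pCons Sz_to_T_0 S_to_T_mconst S_to_T_mvar
      ring_map.hom_zero[OF ring_map_S_to_T] ring_map.hom_one[OF ring_map_S_to_T])

lemma mult_diff_mult_split: "p * q - p' * q' = p * (q - q') + q' * (p - p')" for p :: "'a::comm_ring_1"
  by (simp add: algebra_simps)

lemma mod_y_kernel: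
  fixes p :: "(('n, 'm) tvar, 'k::comm_ring_1) mpoly"
  shows "p - Sz_to_T (mod_y p) \<in> ideal_span (range (\<lambda>j. mvar (YV j)))" (is "_ \<in> ?Y")
proof (induction p rule: mpoly_induct)
  case (const x)
  then show ?case
    by (simp add: mod_y_simps Sz_to_T_pCons Sz_to_T_0 S_to_T_mconst is_ideal_zero is_ideal_span)
next
  case (var v)
  show ?case
  proof (cases v)
    case (YV j)
    then show ?thesis by (simp add: mod_y_simps Sz_to_T_0 ideal.span_base)
  qed (simp_all add: mod_y_simps Sz_to_T_pCons Sz_to_T_0 S_to_T_mvar is_ideal_zero is_ideal_span
      ring_map.hom_zero[OF ring_map_S_to_T] ring_map.hom_one[OF ring_map_S_to_T])
next
  case (add p q)
  have "p + q - Sz_to_T (mod_y (p + q)) = (p - Sz_to_T (mod_y p)) + (q - Sz_to_T (mod_y q))"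
    by (simp add: ring_map.hom_add[OF ring_map_mod_y] ring_map.hom_add[OF ring_map_Sz_to_T])
  with add show ?case by (simp only: is_ideal_add[OF is_ideal_span])
next
  case (mult p q)
  have "p * q - Sz_to_T (mod_y (p * q)) =
      p * (q - Sz_to_T (mod_y q)) + Sz_to_T (mod_y q) * (p - Sz_to_T (mod_y p))"
    by (simp only: ring_map.hom_mult[OF ring_map_mod_y] ring_map.hom_mult[OF ring_map_Sz_to_T]
        mult_diff_mult_split)
  with mult show ?case
    by (simp only: is_ideal_add[OF is_ideal_span] is_ideal_scale[OF is_ideal_span])
qed

text \<open>As \<open>plus_y H\<close> is the preimage of the ideal \<open>H S[z]\<close> under \<open>T \<rightarrow> S[z]\<close>, it is prime if \<open>H\<close> is.\<close>

lemma plus_y_iff: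
  fixes H :: "('n, 'k::comm_ring_1) mpoly set"
  assumes H: "is_ideal H"
  shows "(plus_y H :: (('n, 'm) tvar, 'k) mpoly set) = mod_y -` {u. \<forall>k. coeff u k \<in> H}"
proof
  show "(plus_y H :: (('n, 'm) tvar, 'k) mpoly set) \<subseteq> mod_y -` {u. \<forall>k. coeff u k \<in> H}"
    unfolding plus_y_def
  proof (rule ideal_span_minimal)
    show "is_ideal (mod_y -` {u. \<forall>k. coeff u k \<in> H} :: (('n, 'm) tvar, 'k) mpoly set)"
      by (rule is_ideal_vimage[OF ring_map_mod_y is_ideal_coeffs[OF H]])
    show "S_to_T ` H \<union> range (\<lambda>j. mvar (YV j)) \<subseteq>
        (mod_y -` {u. \<forall>k. coeff u k \<in> H} :: (('n, 'm) tvar, 'k) mpoly set)"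
      by (auto simp: mod_y_S_to_T mod_y_simps is_ideal_zero[OF H] coeff_pCons split: nat.split)
  qed
  show "mod_y -` {u. \<forall>k. coeff u k \<in> H} \<subseteq> (plus_y H :: (('n, 'm) tvar, 'k) mpoly set)"
  proof
    fix p :: "(('n, 'm) tvar, 'k) mpoly"
    assume p: "p \<in> mod_y -` {u. \<forall>k. coeff u k \<in> H}"
    have i: "is_ideal (plus_y H :: (('n, 'm) tvar, 'k) mpoly set)"
      unfolding plus_y_def by (rule is_ideal_span)
    have "S_to_T a \<in> (plus_y H :: (('n, 'm) tvar, 'k) mpoly set)" if "a \<in> H" for a
      unfolding plus_y_def using that by (intro ideal.span_base) auto
    then have "Sz_to_T (mod_y p) \<in> (plus_y H :: (('n, 'm) tvar, 'k) mpoly set)"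
      unfolding Sz_to_T_def poly_altdef using p
      by (intro is_ideal_sum[OF i] is_ideal_scale2[OF i])
        (auto simp: coeff_map_poly ring_map.hom_zero[OF ring_map_S_to_T])
    moreover have "p - Sz_to_T (mod_y p) \<in> plus_y H"
      using mod_y_kernel[of p] unfolding plus_y_def
      by (rule ideal.span_mono[THEN subsetD, rotated]) auto
    ultimately have "p - Sz_to_T (mod_y p) + Sz_to_T (mod_y p) \<in> plus_y H"
      by (intro is_ideal_add[OF i])
    then show "p \<in> plus_y H" by simp
  qed
qed

lemma mvar_YV_in_plus_y: "mvar (YV j) \<in> plus_y H"
  unfolding plus_y_def by (rule ideal.span_base) auto

lemma S_to_T_in_plus_y_iff:
  assumes "is_ideal H"
  shows "S_to_T a \<in> (plus_y H :: (('n, 'm) tvar, 'k::comm_ring_1) mpoly set) \<longleftrightarrow> a \<in> H"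
  using is_ideal_zero[OF assms]
  by (auto simp: plus_y_iff[OF assms] mod_y_S_to_T coeff_pCons split: nat.split)

lemma prime_plus_y: "prime_ideal P \<Longrightarrow> prime_ideal (plus_y P)"
  unfolding plus_y_iff[OF prime_ideal_is_ideal]
  by (rule prime_ideal_vimage[OF ring_map_mod_y prime_ideal_coeffs])

lemma mvar_neq_0: "mvar v \<noteq> (0 :: ('v, 'k::comm_ring_1) mpoly)"
proof
  assume "mvar v = (0 :: ('v, 'k) mpoly)"
  then have "lookup (mvar v :: ('v, 'k) mpoly) (single v 1) = 0" by simp
  then show False by (simp add: mvar_def)
qed

lemma S_to_T_polys_in: "a \<in> polys_in A \<Longrightarrow> S_to_T a \<in> polys_in (XV ` A)"
  unfolding S_to_T_def
  by (rule meval_closed[OF ring_map_mconst])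
    (auto intro: polys_in_add polys_in_mult polys_in_mconst polys_in_mvar)

lemma coeff_mod_y_polys_in:
  assumes "p \<in> polys_in (XV ` A \<union> {ZV})"
  shows "coeff (mod_y p) k \<in> polys_in A"
proof -
  have 1: "1 \<in> polys_in A" using polys_in_mconst[of 1] by (simp add: mconst_def)
  have "mod_y p \<in> {u. \<forall>k. coeff u k \<in> polys_in A}"
    unfolding mod_y_def
    by (rule meval_closed[OF ring_map_const_poly assms])
      (auto simp: coeff_pCons coeff_mult polys_in_zero polys_in_mconst polys_in_mvar 1
        intro!: polys_in_add polys_in_sum polys_in_mult split: nat.split)
  then show ?thesis by blast
qed

text \<open>\<open>T/plus_y P\<close> is the polynomial ring in \<open>z\<close> over \<open>S/P\<close>.\<close>

lemma transc_basis_plus_y: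
  fixes P :: "('n::finite, 'k::field) mpoly set"
  assumes P: "prime_ideal P" and A: "transc_basis A P"
  shows "transc_basis (XV ` A \<union> {ZV}) (plus_y P :: (('n, 'm::finite) tvar, 'k) mpoly set)"
  unfolding transc_basis_def
proof (intro conjI allI impI)
  note i = prime_ideal_is_ideal[OF P]
  let ?PY = "plus_y P :: (('n, 'm) tvar, 'k) mpoly set"
  show "?PY \<inter> polys_in (XV ` A \<union> {ZV}) \<subseteq> {0}"
  proof
    fix p assume p: "p \<in> ?PY \<inter> polys_in (XV ` A \<union> {ZV})"
    then have "coeff (mod_y p) k \<in> P \<inter> polys_in A" for k
      using coeff_mod_y_polys_in[of p A k] by (auto simp: plus_y_iff[OF i])
    then have "coeff (mod_y p) k = 0" for k using A unfolding transc_basis_def by blast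
    then have "mod_y p = 0" by (intro poly_eqI) simp
    moreover have "p \<in> polys_in (range XV \<union> {ZV})"
      using p polys_in_mono[of "XV ` A \<union> {ZV}" "range XV \<union> {ZV}"] by blast
    ultimately show "p \<in> {0}" using Sz_to_T_mod_y[of p] by (simp add: Sz_to_T_0)
  qed
  fix v :: "('n, 'm) tvar" assume v: "v \<notin> XV ` A \<union> {ZV}"
  show "\<not> ?PY \<inter> polys_in (insert v (XV ` A \<union> {ZV})) \<subseteq> {0}"
  proof (cases v)
    case (XV i)
    then have "i \<notin> A" using v by auto
    then obtain F where F: "F \<in> P" "F \<in> polys_in (insert i A)" "F \<noteq> 0"
      using A unfolding transc_basis_def by blast
    have "S_to_T F \<in> polys_in (insert v (XV ` A \<union> {ZV}))"
      using S_to_T_polys_in[OF F(2)] polys_in_mono[of "XV ` insert i A" "insert v (XV ` A \<union> {ZV})"] XV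
      by auto
    moreover have "S_to_T F \<in> ?PY" using F(1) S_to_T_in_plus_y_iff[OF i] by blast
    moreover have "S_to_T F \<noteq> (0 :: (('n, 'm) tvar, 'k) mpoly)"
    proof
      assume "S_to_T F = (0 :: (('n, 'm) tvar, 'k) mpoly)"
      then have "mod_y (S_to_T F :: (('n, 'm) tvar, 'k) mpoly) = 0"
        by (simp add: ring_map.hom_zero[OF ring_map_mod_y])
      then show False using F(3) by (simp add: mod_y_S_to_T)
    qed
    ultimately show ?thesis by blast
  next
    case (YV j)
    have "mvar v \<in> ?PY" by (simp add: YV mvar_YV_in_plus_y)
    moreover have "mvar v \<in> polys_in (insert v (XV ` A \<union> {ZV}))" by (intro polys_in_mvar) simp
    moreover have "mvar v \<noteq> (0 :: (('n, 'm) tvar, 'k) mpoly)" by (rule mvar_neq_0)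
    ultimately show ?thesis by blast
  next
    case ZV
    then show ?thesis using v by simp
  qed
qed

lemma card_Compl_tvar:
  fixes A :: "'n::finite set"
  shows "card (- (XV ` A \<union> {ZV} :: ('n, 'm::finite) tvar set)) = CARD('m) + card (- A)"
proof -
  have "- (XV ` A \<union> {ZV} :: ('n, 'm) tvar set) = XV ` (- A) \<union> range YV"
  proof (rule set_eqI)
    fix v :: "('n, 'm) tvar"
    show "v \<in> - (XV ` A \<union> {ZV}) \<longleftrightarrow> v \<in> XV ` (- A) \<union> range YV" by (cases v) auto
  qed
  moreover have "card (XV ` (- A) \<union> range YV :: ('n, 'm) tvar set) =
      card (XV ` (- A) :: ('n, 'm) tvar set) + card (range YV :: ('n, 'm) tvar set)"
    by (rule card_Un_disjoint) auto
  moreover have "card (XV ` (- A) :: ('n, 'm) tvar set) = card (- A)"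
    by (rule card_image) (auto simp: inj_on_def)
  moreover have "card (range YV :: ('n, 'm) tvar set) = CARD('m)"
    by (rule card_image) (auto simp: inj_on_def)
  ultimately show ?thesis by (simp only:)
qed

lemma prime_height_plus_y:
  fixes P :: "('n::finite, 'k::field) mpoly set"
  assumes P: "prime_ideal P"
  shows "prime_height (plus_y P :: (('n, 'm::finite) tvar, 'k) mpoly set) = enat (CARD('m)) + prime_height P"
proof -
  obtain A where A: "transc_basis A P" using ex_transc_basis[OF P] by blast
  show ?thesis
    unfolding prime_height_eq[OF P A] prime_height_eq[OF prime_plus_y[OF P] transc_basis_plus_y[OF P A]]
    by (simp only: card_Compl_tvar plus_enat_simps)
qed

text \<open>Even and odd powers of \<open>t\<close> do not interfere.\<close>

lemma even_odd_parts_eq_0: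
  fixes u w :: "'a::comm_ring_1 poly"
  assumes "pcompose u [:0, 0, 1:] + [:0, 1:] * pcompose w [:0, 0, 1:] = 0"
  shows "u = 0 \<and> w = 0"
proof -
  have e: "coeff (pcompose u [:0, 0, 1:]) (2 * k) = coeff u k" for u :: "'a poly" and k
  proof (induction u arbitrary: k)
    case (pCons a u)
    then show ?case by (cases k) (simp_all add: pcompose_pCons coeff_pCons)
  qed simp
  have o: "coeff (pcompose u [:0, 0, 1:]) (Suc (2 * k)) = 0" for u :: "'a poly" and k
  proof (induction u arbitrary: k)
    case (pCons a u)
    then show ?case by (cases k) (simp_all add: pcompose_pCons coeff_pCons)
  qed simp
  have c: "coeff (pcompose u [:0, 0, 1:] + [:0, 1:] * pcompose w [:0, 0, 1:]) k = 0" for k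
    using assms by simp
  have "coeff u k = 0" for k
  proof (cases k)
    case 0
    then show ?thesis using c[of 0] e[of u 0] by simp
  next
    case (Suc l)
    then show ?thesis using c[of "Suc (Suc (2 * l))"] e[of u k] o[of w l] by simp
  qed
  moreover have "coeff w k = 0" for k
    using c[of "Suc (2 * k)"] o[of u k] e[of w k] by simp
  ultimately show ?thesis by (auto intro: poly_eqI)
qed

lemma pcompose_square_eq_0: "pcompose u [:0, 0, 1:] = 0 \<Longrightarrow> u = (0 :: 'a::comm_ring_1 poly)"
  using even_odd_parts_eq_0[of u 0] by simp

lemma RLP_vimage: "RLP f = rees_like_map f -` {0}"
  by (auto simp: RLP_def)

lemma prime_RLP:
  fixes f :: "'m \<Rightarrow> ('n::finite, 'k::idom) mpoly"
  shows "prime_ideal (RLP f)"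
  unfolding RLP_vimage
  by (rule prime_ideal_vimage[OF ring_map_rees_like_map prime_ideal_zero_poly[OF prime_ideal_zero_mpoly]])

definition quadric :: "('m \<Rightarrow> ('n, 'k::comm_ring_1) mpoly) \<Rightarrow> 'm \<Rightarrow> 'm \<Rightarrow> (('n, 'm) tvar, 'k) mpoly" where
  "quadric f i j = mvar (YV i) * mvar (YV j) - mvar ZV * (S_to_T (f i) * S_to_T (f j))"

lemma quadric_in_RLP: "quadric f i j \<in> RLP f"
  unfolding RLP_def quadric_def
  by (simp add: ring_map.hom_diff[OF ring_map_rees_like_map] rees_like_map_simps rees_like_map_S_to_T)

lemma quadric_neq_0:
  fixes f :: "'m \<Rightarrow> ('n, 'k::comm_ring_1) mpoly"
  shows "quadric f j j \<noteq> 0"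
proof
  let ?h = "meval (\<lambda>c. [:c:]) (\<lambda>v. if v = YV j then [:0, 1:] else 0) :: (('n, 'm) tvar, 'k) mpoly \<Rightarrow> 'k poly"
  interpret h: ring_map ?h by (rule ring_map_meval[OF ring_map_pCons])
  assume "quadric f j j = (0 :: (('n, 'm) tvar, 'k) mpoly)"
  then have "?h (quadric f j j) = 0" by (simp add: h.hom_zero)
  moreover have "?h (quadric f j j) = [:0, 0, 1:]"
    unfolding quadric_def by (simp add: h.hom_diff h.hom_mult meval_mvar_hom[OF ring_map_pCons])
  ultimately show False by simp
qed

text \<open>Modulo the Rees-like prime, the variables \<open>x\<close> and \<open>z\<close> are independent since \<open>T \<rightarrow> S[t]\<close> is
  injective on \<open>S[z]\<close>, and every \<open>y\<close> is algebraic over them by its quadric.\<close>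

lemma transc_basis_RLP:
  fixes f :: "'m::finite \<Rightarrow> ('n::finite, 'k::field) mpoly"
  shows "transc_basis (range XV \<union> {ZV}) (RLP f)"
  unfolding transc_basis_def
proof (intro conjI allI impI)
  show "RLP f \<inter> polys_in (range XV \<union> {ZV}) \<subseteq> {0}"
  proof
    fix p assume p: "p \<in> RLP f \<inter> polys_in (range XV \<union> {ZV})"
    then have eq: "Sz_to_T (mod_y p) = p" by (intro Sz_to_T_mod_y) blast
    have "rees_like_map f p = 0" using p by (simp add: RLP_def)
    then have "pcompose (mod_y p) [:0, 0, 1:] = 0"
      using rees_like_map_Sz_to_T[of f "mod_y p"] by (simp add: eq)
    then have "mod_y p = 0" by (rule pcompose_square_eq_0)
    then show "p \<in> {0}" using eq by (simp add: Sz_to_T_0)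
  qed
  fix v :: "('n, 'm) tvar" assume v: "v \<notin> range XV \<union> {ZV}"
  then obtain j where j: "v = YV j" by (cases v) auto
  let ?B = "insert v (range XV \<union> {ZV})"
  have S: "S_to_T a \<in> (polys_in ?B :: (('n, 'm) tvar, 'k) mpoly set)" for a
    using S_to_T_polys_in[of a UNIV] polys_in_mono[of "range XV" ?B] by (auto simp: polys_in_UNIV)
  have neg: "- p \<in> polys_in ?B" if "p \<in> polys_in ?B" for p :: "(('n, 'm) tvar, 'k) mpoly"
    using that by (simp add: polys_in_def in_keys_iff)
  have "quadric f j j \<in> polys_in ?B"
    unfolding quadric_def diff_conv_add_uminus
    by (intro polys_in_add neg polys_in_mult polys_in_mvar S) (simp_all add: j)
  then show "\<not> RLP f \<inter> polys_in ?B \<subseteq> {0}"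
    using quadric_in_RLP[of f j j] quadric_neq_0[of f j] by blast
qed

lemma prime_height_RLP:
  fixes f :: "'m::finite \<Rightarrow> ('n::finite, 'k::field) mpoly"
  shows "prime_height (RLP f) = enat (CARD('m))"
  unfolding prime_height_eq[OF prime_RLP transc_basis_RLP]
  using card_Compl_tvar[of "UNIV :: 'n set", where 'm = 'm] by simp

section \<open>Generators of the Rees-like prime\<close>

definition quadric_ideal :: "('m \<Rightarrow> ('n, 'k::comm_ring_1) mpoly) \<Rightarrow> (('n, 'm) tvar, 'k) mpoly set" where
  "quadric_ideal f = ideal_span (range (\<lambda>(i, j). quadric f i j))"

lemma is_ideal_quadric_ideal: "is_ideal (quadric_ideal f)"
  unfolding quadric_ideal_def by (rule is_ideal_span)

lemma quadric_in_quadric_ideal: "quadric f i j \<in> quadric_ideal f"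
  unfolding quadric_ideal_def by (rule ideal.span_base) auto

lemma is_ideal_RLP: "is_ideal (RLP f)"
  unfolding RLP_vimage
  by (rule is_ideal_vimage[OF ring_map_rees_like_map]) (simp add: ideal.subspace_def)

lemma quadric_ideal_subset_RLP: "quadric_ideal f \<subseteq> RLP f"
  unfolding quadric_ideal_def
  by (rule ideal_span_minimal[OF is_ideal_RLP]) (auto simp: quadric_in_RLP)

text \<open>An element of the \<open>S[z]\<close>-submodule of \<open>T\<close> generated by \<open>1\<close> and the \<open>y\<^sub>j\<close>.\<close>

definition linear_form ::
    "('n, 'k) mpoly poly \<Rightarrow> ('m \<Rightarrow> ('n, 'k) mpoly poly) \<Rightarrow> (('n, 'm::finite) tvar, 'k::comm_ring_1) mpoly" where
  "linear_form u c = Sz_to_T u + (\<Sum>j\<in>UNIV. Sz_to_T (c j) * mvar (YV j))"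

interpretation Sz: ring_map Sz_to_T by (rule ring_map_Sz_to_T)
interpretation RL: ring_map "rees_like_map f" for f by (rule ring_map_rees_like_map)

lemma linear_form_add: "linear_form u c + linear_form u' c' = linear_form (u + u') (\<lambda>j. c j + c' j)"
  by (simp add: linear_form_def Sz.hom_add distrib_right sum.distrib add_ac)

text \<open>The product of two linear forms is again one modulo the quadrics, which replace \<open>y\<^sub>i y\<^sub>j\<close> by
  \<open>z f\<^sub>i f\<^sub>j\<close>.\<close>

lemma linear_form_mult:
  fixes f :: "'m::finite \<Rightarrow> ('n, 'k::comm_ring_1) mpoly"
  shows "\<exists>u'' c''. linear_form u c * linear_form u' c' - linear_form u'' c'' \<in> quadric_ideal f"
proof -
  let ?y = "\<lambda>j. mvar (YV j) :: (('n, 'm) tvar, 'k) mpoly"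
  let ?z = "mvar ZV :: (('n, 'm) tvar, 'k) mpoly"
  let ?s = "Sz_to_T :: ('n, 'k) mpoly poly \<Rightarrow> (('n, 'm) tvar, 'k) mpoly"
  let ?b = "\<lambda>c. \<Sum>j\<in>UNIV. ?s (c j) * ?y j"
  let ?q = "\<lambda>i j. ?s (c i) * ?s (c' j) * (?z * (S_to_T (f i) * S_to_T (f j)))"
  let ?u = "u * u' + (\<Sum>i\<in>UNIV. \<Sum>j\<in>UNIV. c i * c' j * [:0, f i * f j:])"
  let ?c = "\<lambda>j. u * c' j + u' * c j"
  have id: "(a + b) * (a' + b') - ((a * a' + e) + (a * b' + a' * b)) = b * b' - e"
    for a b a' b' e :: "(('n, 'm) tvar, 'k) mpoly"
    by (simp add: algebra_simps)
  have z: "?s [:0, f i * f j:] = ?z * (S_to_T (f i) * S_to_T (f j))" for i j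
    by (simp add: Sz_to_T_pCons Sz_to_T_0 ring_map.hom_zero[OF ring_map_S_to_T]
        ring_map.hom_mult[OF ring_map_S_to_T])
  have u: "?s ?u = ?s u * ?s u' + (\<Sum>i\<in>UNIV. \<Sum>j\<in>UNIV. ?q i j)"
    by (simp only: Sz.hom_add Sz.hom_mult Sz.hom_sum z)
  have c: "?b ?c = ?s u * ?b c' + ?s u' * ?b c"
    by (simp only: Sz.hom_add Sz.hom_mult distrib_right sum.distrib sum_distrib_left mult.assoc)
  have bb: "?b c * ?b c' = (\<Sum>i\<in>UNIV. \<Sum>j\<in>UNIV. ?s (c i) * ?s (c' j) * (?y i * ?y j))"
    by (simp only: sum_product mult_ac)
  have "linear_form u c * linear_form u' c' - linear_form ?u ?c =
      ?b c * ?b c' - (\<Sum>i\<in>UNIV. \<Sum>j\<in>UNIV. ?q i j)"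
    unfolding linear_form_def u c by (rule id)
  also have "\<dots> = (\<Sum>i\<in>UNIV. \<Sum>j\<in>UNIV. ?s (c i) * ?s (c' j) * quadric f i j)"
    by (simp only: bb sum_subtractf[symmetric] right_diff_distrib[symmetric] quadric_def)
  also have "\<dots> \<in> quadric_ideal f"
    by (intro is_ideal_sum is_ideal_quadric_ideal is_ideal_scale quadric_in_quadric_ideal)
  finally show ?thesis by blast
qed

lemma linear_form_normal_form:
  fixes f :: "'m::finite \<Rightarrow> ('n, 'k::comm_ring_1) mpoly"
  shows "\<exists>u c. p - linear_form u c \<in> quadric_ideal f"
proof (induction p rule: mpoly_induct)
  note i = is_ideal_quadric_ideal[of f]
  {
    case (const x)
    have "linear_form [:mconst x:] (\<lambda>j. 0) = (mconst x :: (('n, 'm) tvar, 'k) mpoly)"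
      by (simp add: linear_form_def Sz_to_T_pCons Sz_to_T_0 S_to_T_mconst)
    then have "mconst x - linear_form [:mconst x:] (\<lambda>j. 0) \<in> quadric_ideal f"
      using is_ideal_zero[OF i] by simp
    then show ?case by blast
  next
    case (var v)
    have "\<exists>u c. linear_form u c = (mvar v :: (('n, 'm) tvar, 'k) mpoly)"
    proof (cases v)
      case (XV i)
      have "linear_form [:mvar i:] (\<lambda>j :: 'm. 0) = mvar v"
        by (simp add: linear_form_def Sz_to_T_pCons Sz_to_T_0 S_to_T_mvar XV)
      then show ?thesis by blast
    next
      case (YV k)
      have "linear_form 0 (\<lambda>j. if j = k then 1 else 0) = mvar v"
        by (simp add: linear_form_def Sz_to_T_0 YV Sz.hom_one if_distrib[of Sz_to_T]
            if_distrib[of "\<lambda>x. x * _"] cong: if_cong)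
      then show ?thesis by blast
    next
      case ZV
      have "linear_form [:0, 1:] (\<lambda>j :: 'm. 0) = mvar v"
        by (simp add: linear_form_def Sz_to_T_pCons Sz_to_T_0 ZV ring_map.hom_zero[OF ring_map_S_to_T]
            ring_map.hom_one[OF ring_map_S_to_T])
      then show ?thesis by blast
    qed
    then obtain u c where "linear_form u c = (mvar v :: (('n, 'm) tvar, 'k) mpoly)" by blast
    then have "mvar v - linear_form u c \<in> quadric_ideal f" using is_ideal_zero[OF i] by simp
    then show ?case by blast
  next
    case (add p q)
    then obtain u c u' c' where
      1: "p - linear_form u c \<in> quadric_ideal f" "q - linear_form u' c' \<in> quadric_ideal f" by blast
    have "p + q - linear_form (u + u') (\<lambda>j. c j + c' j) =
        (p - linear_form u c) + (q - linear_form u' c')"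
      by (simp only: linear_form_add[symmetric]) simp
    with is_ideal_add[OF i 1] show ?case by (metis (no_types))
  next
    case (mult p q)
    then obtain u c u' c' where
      1: "p - linear_form u c \<in> quadric_ideal f" "q - linear_form u' c' \<in> quadric_ideal f" by blast
    obtain u'' c'' where
      2: "linear_form u c * linear_form u' c' - linear_form u'' c'' \<in> quadric_ideal f"
      using linear_form_mult[of u c u' c' f] by blast
    have "p * q - linear_form u'' c'' = (p * q - linear_form u c * linear_form u' c') +
        (linear_form u c * linear_form u' c' - linear_form u'' c'')"
      by simp
    also have "\<dots> \<in> quadric_ideal f"
      unfolding mult_diff_mult_split by (intro is_ideal_add[OF i] is_ideal_scale[OF i] 1 2)
    finally show ?case by blast
  }
qed

text \<open>Modulo the quadrics, an element of \<open>T\<close> is a linear form, and \<open>T \<rightarrow> S[t]\<close> maps its constant term to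
  even and the rest to odd powers of \<open>t\<close>. For an element of \<open>RLP f\<close> the constant term is therefore
  zero, and the coefficients of the \<open>y\<^sub>j\<close> form a syzygy.\<close>

lemma RLP_quadrics_syzygies:
  fixes f :: "'m::finite \<Rightarrow> ('n, 'k::comm_ring_1) mpoly"
  assumes "p \<in> RLP f"
  shows "\<exists>c :: 'm \<Rightarrow> (('n, 'm) tvar, 'k) mpoly. (\<Sum>j\<in>UNIV. c j * S_to_T (f j)) = 0 \<and>
    p - (\<Sum>j\<in>UNIV. c j * mvar (YV j)) \<in> quadric_ideal f"
proof -
  obtain u c where uc: "p - linear_form u c \<in> quadric_ideal f"
    using linear_form_normal_form by blast
  interpret pc: ring_map "\<lambda>u. pcompose u [:0, 0, 1:] :: ('n, 'k) mpoly poly" by (rule ring_map_pcompose)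
  have "rees_like_map f (p - linear_form u c) = 0" "rees_like_map f p = 0"
    using uc quadric_ideal_subset_RLP assms by (auto simp: RLP_def)
  then have "rees_like_map f (linear_form u c) = 0"
    by (simp add: RL.hom_diff)
  moreover have "[:0, f j:] = [:0, 1:] * pcompose [:f j:] [:0, 0, 1:]" for j by simp
  then have "rees_like_map f (Sz_to_T (c j) * mvar (YV j)) =
      [:0, 1:] * pcompose (c j * [:f j:]) [:0, 0, 1:]" for j
    unfolding RL.hom_mult pc.hom_mult rees_like_map_simps rees_like_map_Sz_to_T rees_like_var.simps
    by (simp only: mult_ac)
  then have "rees_like_map f (linear_form u c) = pcompose u [:0, 0, 1:] +
      [:0, 1:] * pcompose (\<Sum>j\<in>UNIV. c j * [:f j:]) [:0, 0, 1:]"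
    unfolding linear_form_def RL.hom_add RL.hom_sum rees_like_map_Sz_to_T pc.hom_sum sum_distrib_left
    by (simp only:)
  ultimately have u: "u = 0" and c: "(\<Sum>j\<in>UNIV. c j * [:f j:]) = 0"
    using even_odd_parts_eq_0[of u] by auto
  have "(\<Sum>j\<in>UNIV. Sz_to_T (c j) * S_to_T (f j)) =
      (Sz_to_T (\<Sum>j\<in>UNIV. c j * [:f j:]) :: (('n, 'm) tvar, 'k) mpoly)"
    by (simp only: Sz.hom_sum Sz.hom_mult) (simp add: Sz_to_T_pCons Sz_to_T_0)
  then show ?thesis
    using uc c u by (intro exI[of _ "\<lambda>j. Sz_to_T (c j)"]) (simp add: linear_form_def Sz_to_T_0)
qed


section \<open>Partial derivatives\<close>

lemma mderiv_superset:
  assumes "finite A" "keys p \<subseteq> A"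
  shows "mderiv v p = (\<Sum>a\<in>A. single (a - single v 1) (of_nat (lookup a v) * lookup p a))"
  unfolding mderiv_def using assms
  by (intro sum.mono_neutral_left) (auto simp: in_keys_iff)

lemma mderiv_add: "mderiv v (p + q) = mderiv v p + mderiv v q"
proof -
  let ?A = "keys p \<union> keys q"
  have "keys (p + q) \<subseteq> ?A" by (rule Poly_Mapping.keys_add)
  then show ?thesis
    by (simp add: mderiv_superset[of ?A] lookup_add distrib_left single_add sum.distrib)
qed

lemma mderiv_zero: "mderiv v 0 = 0"
  by (simp add: mderiv_def)

lemma mderiv_sum: "mderiv v (sum w A) = (\<Sum>i\<in>A. mderiv v (w i))"
  by (induction A rule: infinite_finite_induct) (simp_all add: mderiv_zero mderiv_add)

lemma mderiv_diff: "mderiv v (p - q) = mderiv v p - mderiv v q"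
  using mderiv_add[of v "p - q" q] by simp

lemma mderiv_single: "mderiv v (single a x) = single (a - single v 1) (of_nat (lookup a v) * x)"
  by (simp add: mderiv_superset[of "{a}"])

lemma mpoly_single_induct [case_names single add]:
  fixes p :: "('v, 'k::comm_ring_1) mpoly"
  assumes "\<And>a x. P (single a x)" and "\<And>p q. P p \<Longrightarrow> P q \<Longrightarrow> P (p + q)"
  shows "P p"
proof -
  have "P (\<Sum>a\<in>A. single a (lookup p a))" for A
    by (induction A rule: infinite_finite_induct) (use assms(1)[of 0 0] in \<open>auto intro: assms\<close>)
  then show ?thesis by (subst mpoly_sum_single)
qed

lemma mderiv_mult: "mderiv v (p * q) = mderiv v p * q + p * mderiv v q"
proof (induction p rule: mpoly_single_induct)
  case (single a x)
  show ?case
  proof (induction q rule: mpoly_single_induct)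
    case (single b y)
    have l: "single (a - single v 1 + b) (of_nat (lookup a v) * x * y) =
        single (a + b - single v 1) (of_nat (lookup a v) * x * y)"
    proof (cases "lookup a v = 0")
      case False
      then have "a - single v 1 + b = a + b - single v 1"
        by (intro poly_mapping_eqI) (auto simp: lookup_add lookup_minus lookup_single when_def)
      then show ?thesis by simp
    qed simp
    have r: "single (a + (b - single v 1)) (x * (of_nat (lookup b v) * y)) =
        single (a + b - single v 1) (x * (of_nat (lookup b v) * y))"
    proof (cases "lookup b v = 0")
      case False
      then have "a + (b - single v 1) = a + b - single v 1"
        by (intro poly_mapping_eqI) (auto simp: lookup_add lookup_minus lookup_single when_def)
      then show ?thesis by simp
    qed simp
    show ?case
      by (simp only: mult_single mderiv_single l r lookup_add of_nat_add)
        (simp only: single_add[symmetric] distrib_left distrib_right mult_ac)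
  next
    case (add p q)
    then show ?case by (simp only: distrib_left mderiv_add add_ac)
  qed
next
  case (add p q)
  then show ?case by (simp only: distrib_right mderiv_add add_ac)
qed

lemma mderiv_mvar: "mderiv v (mvar w) = (if v = w then 1 else 0)"
  unfolding mvar_def mderiv_single by (auto simp: lookup_single when_def)

lemma mderiv_mconst: "mderiv v (mconst x) = 0"
  unfolding mconst_def mderiv_single by simp

lemma mderiv_S_to_T:
  assumes "v \<notin> range XV"
  shows "mderiv v (S_to_T a) = 0"
  using assms
  by (induction a rule: mpoly_induct)
    (auto simp: S_to_T_mconst S_to_T_mvar mderiv_mconst mderiv_mvar mderiv_add mderiv_mult
      ring_map.hom_add[OF ring_map_S_to_T] ring_map.hom_mult[OF ring_map_S_to_T])

lemma mderiv_mult_in_ideal: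
  assumes Q: "is_ideal Q" and "p \<in> Q" "q \<in> Q"
  shows "mderiv v (p * q) \<in> Q"
  unfolding mderiv_mult
  by (rule is_ideal_add[OF Q is_ideal_scale[OF Q \<open>q \<in> Q\<close>] is_ideal_scale2[OF Q \<open>p \<in> Q\<close>]])

section \<open>Jacobian minors\<close>

lemma RLP_subset:
  fixes f :: "'m::finite \<Rightarrow> ('n, 'k::comm_ring_1) mpoly"
  assumes Q: "is_ideal Q" and y: "\<And>j. mvar (YV j) \<in> Q" and f: "\<And>j. S_to_T (f j) \<in> Q"
  shows "RLP f \<subseteq> Q"
proof
  fix p assume "p \<in> RLP f"
  then obtain c where c: "p - (\<Sum>j\<in>UNIV. c j * mvar (YV j)) \<in> quadric_ideal f"
    using RLP_quadrics_syzygies by blast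
  have "quadric f i j \<in> Q" for i j
    unfolding quadric_def by (intro is_ideal_diff[OF Q] is_ideal_scale[OF Q] y f)
  then have "quadric_ideal f \<subseteq> Q"
    unfolding quadric_ideal_def by (intro ideal_span_minimal[OF Q]) auto
  then have "(p - (\<Sum>j\<in>UNIV. c j * mvar (YV j))) + (\<Sum>j\<in>UNIV. c j * mvar (YV j)) \<in> Q"
    using c by (intro is_ideal_add[OF Q] is_ideal_sum[OF Q] is_ideal_scale[OF Q] y) blast
  then show "p \<in> Q" by simp
qed

text \<open>Modulo an ideal that contains \<open>I\<close> and \<open>y\<close>, the quadrics have zero differential, so the
  differential of an element of \<open>RLP f\<close> is that of a syzygy.\<close>

lemma RLP_differential:
  fixes f :: "'m::finite \<Rightarrow> ('n, 'k::comm_ring_1) mpoly"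
  assumes Q: "is_ideal Q" and y: "\<And>j. mvar (YV j) \<in> Q" and f: "\<And>j. S_to_T (f j) \<in> Q"
    and p: "p \<in> RLP f"
  shows "\<exists>c. (\<Sum>j\<in>UNIV. c j * S_to_T (f j)) = 0 \<and>
    (\<forall>j. mderiv (YV j) p - c j \<in> Q) \<and> (\<forall>v. v \<notin> range YV \<longrightarrow> mderiv v p \<in> Q)"
proof -
  obtain c where c: "(\<Sum>j\<in>UNIV. c j * S_to_T (f j)) = 0"
    "p - (\<Sum>j\<in>UNIV. c j * mvar (YV j)) \<in> quadric_ideal f" (is "?r \<in> _")
    using RLP_quadrics_syzygies[OF p] by blast
  have quadric: "quadric f i j \<in> Q" for i j
    unfolding quadric_def by (intro is_ideal_diff[OF Q] is_ideal_scale[OF Q] y f)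
  have dquadric: "mderiv v (quadric f i j) \<in> Q" for v i j
    unfolding quadric_def mderiv_diff mderiv_mult[of v "mvar ZV"]
    by (intro is_ideal_diff[OF Q] is_ideal_add[OF Q] mderiv_mult_in_ideal[OF Q]
        is_ideal_scale[OF Q] y f)
  have r: "mderiv v r \<in> Q" if "r \<in> quadric_ideal f" for r v
    using that unfolding quadric_ideal_def
  proof (induction rule: ideal.span_induct_alt)
    case base
    show ?case by (simp add: mderiv_zero is_ideal_zero[OF Q])
  next
    case (step a x z)
    then have "x \<in> Q" "mderiv v x \<in> Q" using quadric dquadric by auto
    then show ?case
      unfolding mderiv_add mderiv_mult
      by (intro is_ideal_add[OF Q] is_ideal_scale[OF Q] step) auto
  qed
  have "mderiv v (c j * mvar (YV j)) = mvar (YV j) * mderiv v (c j) + (if v = YV j then c j else 0)" for v j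
    by (simp add: mderiv_mult mderiv_mvar mult.commute)
  then have "mderiv v p - (\<Sum>j\<in>UNIV. if v = YV j then c j else 0) =
      mderiv v ?r + (\<Sum>j\<in>UNIV. mvar (YV j) * mderiv v (c j))" for v
    by (simp add: mderiv_diff mderiv_sum sum.distrib)
  moreover have "mderiv v ?r + (\<Sum>j\<in>UNIV. mvar (YV j) * mderiv v (c j)) \<in> Q" for v
    by (intro is_ideal_add[OF Q] is_ideal_sum[OF Q] is_ideal_scale2[OF Q] y r c(2))
  ultimately have d: "mderiv v p - (\<Sum>j\<in>UNIV. if v = YV j then c j else 0) \<in> Q" for v
    by simp
  have "mderiv (YV j) p - c j \<in> Q" for j using d[of "YV j"] by simp
  moreover have "mderiv v p \<in> Q" if "v \<notin> range YV" for v
  proof -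
    have "(\<Sum>j\<in>UNIV. if v = YV j then c j else 0) = 0" using that by (intro sum.neutral) auto
    then show ?thesis using d[of v] by simp
  qed
  ultimately show ?thesis using c(1) by blast
qed

lemma prod_diff_in_ideal:
  assumes H: "is_ideal H" and "\<And>i. i \<in> A \<Longrightarrow> u i - w i \<in> H"
  shows "prod u A - prod w A \<in> H"
  using assms(2)
proof (induction A rule: infinite_finite_induct)
  case (insert i A)
  then show ?case
    by (simp add: mult_diff_mult_split is_ideal_add[OF H] is_ideal_scale[OF H])
qed (simp_all add: is_ideal_zero[OF H])

lemma det_diff_in_ideal:
  fixes A B :: "'a::comm_ring_1 ^ 'm ^ 'm"
  assumes H: "is_ideal H" and AB: "\<And>i j. A $ i $ j - B $ i $ j \<in> H"
  shows "det A - det B \<in> H"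
  unfolding det_def sum_subtractf[symmetric] right_diff_distrib[symmetric]
  by (intro is_ideal_sum[OF H] is_ideal_scale[OF H] prod_diff_in_ideal[OF H] AB)

text \<open>A column operation turns the determinant of a matrix with a kernel vector \<open>w\<close> into
  \<open>w\<^sub>k\<close> times itself on the one hand, and into zero on the other.\<close>

lemma kernel_times_det:
  fixes A :: "'a::comm_ring_1 ^ 'm ^ 'm"
  assumes "\<And>i. (\<Sum>j\<in>UNIV. A $ i $ j * w j) = 0"
  shows "w k * det A = 0"
proof -
  let ?B = "transpose A"
  have s: "(\<Sum>j\<in>UNIV. w j *s ?B $ j) = 0"
    using assms by (simp add: vec_eq_iff transpose_def mult.commute)
  have "0 = det (\<chi> i. if i = k then \<Sum>j\<in>UNIV. w j *s ?B $ j else ?B $ i)"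
    unfolding s by (rule det_row_0[symmetric])
  also have "\<dots> = (\<Sum>j\<in>UNIV. det (\<chi> i. if i = k then w j *s ?B $ j else ?B $ i))"
    using det_linear_row_sum[of UNIV k "\<lambda>_ j. w j *s ?B $ j" "\<lambda>i. ?B $ i"] by simp
  also have "\<dots> = (\<Sum>j\<in>UNIV. w j * det (\<chi> i. if i = k then ?B $ j else ?B $ i))"
    using det_row_mul[of k _ "\<lambda>_. ?B $ _" "\<lambda>i. ?B $ i"] by simp
  also have "\<dots> = (\<Sum>j\<in>UNIV. if j = k then w k * det ?B else 0)"
  proof (rule sum.cong[OF refl])
    fix j :: 'm
    show "w j * det (\<chi> i. if i = k then ?B $ j else ?B $ i) = (if j = k then w k * det ?B else 0)"
    proof (cases "j = k")
      case True
      have "(\<chi> i. if i = k then ?B $ k else ?B $ i) = ?B" by (simp add: vec_eq_iff)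
      then show ?thesis unfolding True by simp
    next
      case False
      have "det (\<chi> i. if i = k then ?B $ j else ?B $ i) = 0"
        by (rule det_identical_rows[of j k]) (use False in \<open>simp_all add: row_def\<close>)
      then show ?thesis using False by simp
    qed
  qed
  also have "\<dots> = w k * det A" by simp
  finally show ?thesis by simp
qed

text \<open>Modulo \<open>Q\<close>, a minor that uses a column other than those of \<open>y\<close> has a zero column, and the
  minor of all columns of \<open>y\<close> is a determinant of syzygies, of which \<open>f\<close> is a kernel vector.\<close>

lemma minor_in_ideal:
  fixes f :: "'m::finite \<Rightarrow> ('n::finite, 'k::idom) mpoly"
    and Q :: "(('n, 'm) tvar, 'k) mpoly set"
  assumes Q: "is_ideal Q" and y: "\<And>j. mvar (YV j) \<in> Q" and f: "\<And>j. S_to_T (f j) \<in> Q"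
    and f0: "f k \<noteq> 0" and g: "range g \<subseteq> RLP f" and v: "inj v"
  shows "det ((\<chi> i j. mderiv (v j) (g i)) :: (('n, 'm) tvar, 'k) mpoly ^ 'm ^ 'm) \<in> Q" (is "det ?M \<in> Q")
proof (cases "range v \<subseteq> range YV")
  case True
  then have "\<forall>j. \<exists>s. v j = YV s" by blast
  then obtain \<sigma> where \<sigma>: "\<And>j. v j = YV (\<sigma> j)" by metis
  have "inj \<sigma>" using v by (auto simp: inj_def \<sigma>)
  then have bij: "bij \<sigma>" by (simp add: bij_def finite_UNIV_inj_surj)
  have "\<exists>c. (\<Sum>j\<in>UNIV. c j * S_to_T (f j)) = 0 \<and> (\<forall>j. mderiv (YV j) (g i) - c j \<in> Q)" for i
  proof -
    have "g i \<in> RLP f" using g by blast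
    from RLP_differential[OF Q y f this] show ?thesis by (elim exE conjE) (intro exI conjI)
  qed
  then have "\<forall>i. \<exists>c. (\<Sum>j\<in>UNIV. c j * S_to_T (f j)) = 0 \<and> (\<forall>j. mderiv (YV j) (g i) - c j \<in> Q)" ..
  from choice[OF this] obtain c where
    "\<forall>i. (\<Sum>j\<in>UNIV. c i j * S_to_T (f j)) = 0 \<and> (\<forall>j. mderiv (YV j) (g i) - c i j \<in> Q)" ..
  then have c: "\<And>i. (\<Sum>j\<in>UNIV. c i j * S_to_T (f j)) = 0" "\<And>i j. mderiv (YV j) (g i) - c i j \<in> Q"
    by simp_all
  let ?C = "(\<chi> i j. c i (\<sigma> j)) :: (('n, 'm) tvar, 'k) mpoly ^ 'm ^ 'm"
  obtain k' where k': "\<sigma> k' = k" using bij by (metis bij_pointE)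
  have "S_to_T (f (\<sigma> k')) * det ?C = 0"
  proof (rule kernel_times_det[of ?C "\<lambda>j. S_to_T (f (\<sigma> j))" k'])
    fix i
    have "(\<Sum>j\<in>UNIV. c i (\<sigma> j) * S_to_T (f (\<sigma> j))) = (\<Sum>j\<in>UNIV. c i j * S_to_T (f j))"
      using sum.reindex_bij_betw[OF bij, of "\<lambda>j. c i j * S_to_T (f j)"] .
    then show "(\<Sum>j\<in>UNIV. ?C $ i $ j * S_to_T (f (\<sigma> j))) = 0" by (simp add: c(1))
  qed
  moreover have "S_to_T (f k) \<noteq> (0 :: (('n, 'm) tvar, 'k) mpoly)"
  proof
    assume "S_to_T (f k) = (0 :: (('n, 'm) tvar, 'k) mpoly)"
    then have "mod_y (S_to_T (f k) :: (('n, 'm) tvar, 'k) mpoly) = 0"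
      by (simp add: ring_map.hom_zero[OF ring_map_mod_y])
    then show False using f0 by (simp add: mod_y_S_to_T)
  qed
  ultimately have "det ?C = 0" by (simp add: k' mpoly_mult_eq_0_iff)
  moreover have "det ?M - det ?C \<in> Q"
    by (rule det_diff_in_ideal[OF Q]) (simp add: \<sigma> c(2))
  ultimately show ?thesis by simp
next
  case False
  then obtain k where k: "v k \<notin> range YV" by blast
  have col: "mderiv (v k) (g i) \<in> Q" for i
  proof -
    have "g i \<in> RLP f" using g by blast
    from RLP_differential[OF Q y f this] show ?thesis using k by (elim exE conjE) simp
  qed
  let ?C = "(\<chi> i j. if j = k then 0 else mderiv (v j) (g i)) :: (('n, 'm) tvar, 'k) mpoly ^ 'm ^ 'm"
  have "1 * det ?C = 0"
    using kernel_times_det[of ?C "\<lambda>j. if j = k then 1 else 0" k] by (simp add: sum.neutral)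
  moreover have "det ?M - det ?C \<in> Q"
    by (rule det_diff_in_ideal[OF Q]) (simp add: col is_ideal_zero[OF Q])
  ultimately show ?thesis by simp
qed

text \<open>Modulo \<open>RLP f\<close>, differentiation is linear over \<open>T\<close> on \<open>RLP f\<close>. The minors of elements of \<open>RLP f\<close>
  are therefore combinations of those of generators.\<close>

lemma minor_in_span_minors:
  fixes f :: "'m::finite \<Rightarrow> ('n, 'k::comm_ring_1) mpoly" and G :: "(('n, 'm) tvar, 'k) mpoly set"
  assumes G: "ideal_span G = RLP f" and v: "inj v" and g: "range g \<subseteq> RLP f"
  shows "det ((\<chi> i j. mderiv (v j) (g i)) :: (('n, 'm) tvar, 'k) mpoly ^ 'm ^ 'm)
    \<in> ideal_span (RLP f \<union> jacobian_minors G)" (is "_ \<in> ?H")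
proof -
  have H: "is_ideal ?H" by (rule is_ideal_span)
  have GR: "G \<subseteq> RLP f" using ideal.span_superset[of G] by (simp add: G)
  define drow :: "(('n, 'm) tvar, 'k) mpoly \<Rightarrow> (('n, 'm) tvar, 'k) mpoly ^ 'm"
    where "drow r = (\<chi> j. mderiv (v j) r)" for r
  have "det (\<chi> i. drow (g i)) \<in> ?H" if "finite F" "\<And>i. i \<in> F \<Longrightarrow> g i \<in> RLP f" "\<And>i. i \<notin> F \<Longrightarrow> g i \<in> G" for F g
    using that
  proof (induction F arbitrary: g)
    case empty
    show ?case
    proof (cases "inj g")
      case True
      then have "det (\<chi> i. drow (g i)) \<in> jacobian_minors G"
        unfolding jacobian_minors_def drow_def using empty v by blast
      then show ?thesis by (intro ideal.span_base) auto
    next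
      case False
      then obtain i j where "i \<noteq> j" "g i = g j" by (auto simp: inj_def)
      then have "det (\<chi> i. drow (g i)) = 0"
        by (intro det_identical_rows[of i j]) (simp_all add: row_def)
      then show ?thesis by (simp add: is_ideal_zero[OF H])
    qed
  next
    case (insert k F)
    define M where "M r = det (\<chi> i. if i = k then drow r else drow (g i))" for r
    have M: "M r = det (\<chi> i. drow ((g(k := r)) i))" for r
      unfolding M_def by (rule arg_cong[where f = det]) (simp add: vec_eq_iff)
    have "M r \<in> ?H" if "r \<in> ideal_span G" for r
      using that
    proof (induction rule: ideal.span_induct_alt)
      case base
      have z: "drow 0 = 0" by (simp add: drow_def vec_eq_iff mderiv_zero)
      have "M 0 = 0" unfolding M_def z by (rule det_row_0)
      then show ?case by (simp add: is_ideal_zero[OF H])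
    next
      case (step c x y)
      have rw: "drow (c * x + y) = (c *s drow x + x *s drow c) + drow y"
        by (simp add: drow_def vec_eq_iff mderiv_add mderiv_mult mult.commute)
      have "M (c * x + y) = (c * M x + x * M c) + M y"
        unfolding M_def rw by (simp only: det_row_add det_row_mul)
      moreover have "M x \<in> ?H"
        unfolding M using insert.prems insert.hyps step(1) GR by (intro insert.IH) auto
      moreover have "x \<in> ?H" using step(1) GR by (intro ideal.span_base) auto
      ultimately show ?case
        by (simp add: is_ideal_add[OF H] is_ideal_scale[OF H] is_ideal_scale2[OF H] step(2))
    qed
    then have "M (g k) \<in> ?H" using insert.prems(1)[of k] G by simp
    then show ?case by (simp add: M)
  qed
  from this[of UNIV g] show ?thesis using g by (auto simp: drow_def)
qed

lemma prime_ideal_prod: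
  assumes P: "prime_ideal P" and "finite A" "prod w A \<in> P"
  shows "\<exists>i\<in>A. w i \<in> P"
  using assms(2,3)
  by (induction A rule: finite_induct) (auto simp: prime_ideal_one[OF P] prime_ideal_mult[OF P])

text \<open>The rows \<open>f\<^sub>k y\<^sub>i - f\<^sub>i y\<^sub>k\<close> for \<open>i \<noteq> k\<close> and \<open>y\<^sub>k\<^sup>2 - z f\<^sub>k\<^sup>2\<close> have, in the columns \<open>y\<^sub>i\<close> for \<open>i \<noteq> k\<close>
  and \<open>z\<close>, a diagonal minor that is a power of \<open>f\<^sub>k\<close> up to sign.\<close>

lemma generators_in_prime:
  fixes f :: "'m::finite \<Rightarrow> ('n, 'k::comm_ring_1) mpoly" and G :: "(('n, 'm) tvar, 'k) mpoly set"
  assumes G: "ideal_span G = RLP f" and Q: "prime_ideal Q" and HQ: "RLP f \<union> jacobian_minors G \<subseteq> Q"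
  shows "S_to_T (f k) \<in> Q" "mvar (YV k) \<in> Q"
proof -
  note i = prime_ideal_is_ideal[OF Q]
  let ?y = "\<lambda>j. mvar (YV j) :: (('n, 'm) tvar, 'k) mpoly"
  let ?f = "\<lambda>j. S_to_T (f j) :: (('n, 'm) tvar, 'k) mpoly"
  define g where "g i = (if i = k then quadric f k k else ?f k * ?y i - ?f i * ?y k)" for i
  define v where "v i = (if i = k then ZV else YV i :: ('n, 'm) tvar)" for i
  let ?M = "(\<chi> i j. mderiv (v j) (g i)) :: (('n, 'm) tvar, 'k) mpoly ^ 'm ^ 'm"
  have dS: "mderiv ZV (S_to_T a) = (0 :: (('n, 'm) tvar, 'k) mpoly)"
    "mderiv (YV j) (S_to_T a) = (0 :: (('n, 'm) tvar, 'k) mpoly)" for a j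
    by (rule mderiv_S_to_T; blast)+
  have "inj v" by (auto simp: inj_def v_def)
  moreover have "range g \<subseteq> RLP f"
    using quadric_in_RLP[of f k k]
    by (auto simp: g_def RLP_def RL.hom_diff rees_like_map_simps rees_like_map_S_to_T mult.commute)
  ultimately have "det ?M \<in> ideal_span (RLP f \<union> jacobian_minors G)"
    by (rule minor_in_span_minors[OF G])
  then have "det ?M \<in> Q" using ideal_span_minimal[OF i HQ] by blast
  moreover have "det ?M = (\<Prod>i\<in>UNIV. ?M $ i $ i)"
    by (rule det_diagonal)
      (auto simp: g_def v_def quadric_def mderiv_diff mderiv_mult mderiv_mvar dS)
  ultimately obtain l where l: "?M $ l $ l \<in> Q"
    using prime_ideal_prod[OF Q, of UNIV "\<lambda>i. ?M $ i $ i"] by auto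
  have "?M $ l $ l = (if l = k then - (?f k * ?f k) else ?f k)"
    by (auto simp: g_def v_def quadric_def mderiv_diff mderiv_mult mderiv_mvar dS)
  then have "?f k \<in> Q"
    using l prime_ideal_mult[OF Q] is_ideal_scale[OF i, of "- (?f k * ?f k)" "- 1"]
    by (auto split: if_splits)
  then show "?f k \<in> Q" .
  have "quadric f k k \<in> Q" using HQ quadric_in_RLP[of f k k] by blast
  then have "quadric f k k + mvar ZV * (?f k * ?f k) \<in> Q"
    using \<open>?f k \<in> Q\<close> by (intro is_ideal_add[OF i] is_ideal_scale[OF i])
  then have "?y k * ?y k \<in> Q" by (simp add: quadric_def)
  then show "?y k \<in> Q" using prime_ideal_mult[OF Q] by blast
qed

text \<open>A radical is determined by the primes above it. As far as primes are concerned, the Jacobian ideal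
  may therefore be replaced by the much simpler \<open>plus_y I\<close>.\<close>

lemma prime_over_singular_iff:
  fixes f :: "'m::finite \<Rightarrow> ('n::finite, 'k::idom) mpoly" and G :: "(('n, 'm) tvar, 'k) mpoly set"
  assumes G: "ideal_span G = RLP f" and f: "f k \<noteq> 0" and Q: "prime_ideal Q"
  shows "ideal_span (RLP f \<union> jacobian_minors G) \<subseteq> Q \<longleftrightarrow> plus_y (ideal_span (range f)) \<subseteq> Q"
proof
  note i = prime_ideal_is_ideal[OF Q]
  assume "ideal_span (RLP f \<union> jacobian_minors G) \<subseteq> Q"
  then have "RLP f \<union> jacobian_minors G \<subseteq> Q"
    using ideal.span_superset by blast
  note gen = generators_in_prime[OF G Q this]
  have "ideal_span (range f) \<subseteq> S_to_T -` Q"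
    using gen(1) by (intro ideal_span_minimal is_ideal_vimage[OF ring_map_S_to_T i]) auto
  then show "plus_y (ideal_span (range f)) \<subseteq> Q"
    unfolding plus_y_def using gen(2) by (intro ideal_span_minimal[OF i]) auto
next
  note i = prime_ideal_is_ideal[OF Q]
  assume sub: "plus_y (ideal_span (range f)) \<subseteq> Q"
  have y: "mvar (YV j) \<in> Q" for j by (rule subsetD[OF sub mvar_YV_in_plus_y])
  have fQ: "S_to_T (f j) \<in> Q" for j
  proof -
    have "f j \<in> ideal_span (range f)" by (simp add: ideal.span_base)
    then have "S_to_T (f j) \<in> (plus_y (ideal_span (range f)) :: (('n, 'm) tvar, 'k) mpoly set)"
      by (simp add: S_to_T_in_plus_y_iff is_ideal_span)
    then show ?thesis by (rule subsetD[OF sub])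
  qed
  have "jacobian_minors G \<subseteq> Q"
  proof
    fix d assume "d \<in> jacobian_minors G"
    then obtain g :: "'m \<Rightarrow> (('n, 'm) tvar, 'k) mpoly" and v :: "'m \<Rightarrow> ('n, 'm) tvar"
      where d: "d = det (\<chi> i j. mderiv (v j) (g i))" "range g \<subseteq> G" "inj v"
      unfolding jacobian_minors_def by blast
    have "range g \<subseteq> RLP f" using d(2) ideal.span_superset[of G] G by blast
    from minor_in_ideal[OF i y fQ f this d(3)] show "d \<in> Q" unfolding d(1) .
  qed
  then show "ideal_span (RLP f \<union> jacobian_minors G) \<subseteq> Q"
    using RLP_subset[OF i y fQ] by (intro ideal_span_minimal[OF i]) auto
qed


section \<open>Minimal primes and heights\<close>

lemma prime_height_mono:
  assumes Q: "prime_ideal Q" and PQ: "P \<subseteq> Q"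
  shows "prime_height P \<le> prime_height Q"
proof (cases "P = Q")
  case False
  show ?thesis
    unfolding prime_height_def[of P]
  proof (rule Sup_least, clarify)
    fix l and C :: "nat \<Rightarrow> 'a set"
    assume C: "\<forall>i\<le>l. prime_ideal (C i)" "\<forall>i<l. C i \<subset> C (Suc i)" "P = C l"
    let ?C = "C(Suc l := Q)"
    have "\<forall>i\<le>Suc l. prime_ideal (?C i)" using C(1) Q by (auto simp: le_Suc_eq)
    moreover have "\<forall>i<Suc l. ?C i \<subset> ?C (Suc i)" using C PQ False by (auto simp: less_Suc_eq)
    ultimately have "enat (Suc l) \<le> prime_height Q"
      unfolding prime_height_def
      by (intro Sup_upper CollectI exI[of _ "Suc l"] conjI exI[of _ ?C]) simp_all
    then show "enat l \<le> prime_height Q" by (rule order_trans[rotated]) simp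
  qed
qed simp

lemma height_prime: "prime_ideal P \<Longrightarrow> height P = prime_height P"
  unfolding height_def by (intro antisym INF_lower INF_greatest prime_height_mono) auto

lemma S_to_T_in_plus_y: "a \<in> H \<Longrightarrow> S_to_T a \<in> plus_y H"
  unfolding plus_y_def by (rule ideal.span_base) auto

text \<open>The primes containing \<open>plus_y I\<close> are governed by the primes \<open>plus_y P\<close>, where \<open>P\<close> is their
  contraction to \<open>S\<close>.\<close>

lemma contraction_over_plus_y:
  fixes Q :: "(('n, 'm) tvar, 'k::comm_ring_1) mpoly set"
  assumes "prime_ideal Q" "plus_y I \<subseteq> Q"
  shows "prime_ideal (S_to_T -` Q)" "I \<subseteq> S_to_T -` Q" "plus_y (S_to_T -` Q) \<subseteq> Q"
proof -
  show "prime_ideal (S_to_T -` Q)" by (rule prime_ideal_vimage[OF ring_map_S_to_T assms(1)])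
  show "I \<subseteq> S_to_T -` Q"
    using subsetD[OF assms(2) S_to_T_in_plus_y] by auto
  show "plus_y (S_to_T -` Q) \<subseteq> Q"
    unfolding plus_y_def using subsetD[OF assms(2) mvar_YV_in_plus_y]
    by (intro ideal_span_minimal prime_ideal_is_ideal assms(1)) auto
qed

lemma plus_y_mono: "H \<subseteq> K \<Longrightarrow> plus_y H \<subseteq> plus_y K"
  unfolding plus_y_def by (intro ideal.span_mono) auto

lemma minimal_primesD:
  assumes "P \<in> minimal_primes H"
  shows "prime_ideal P" "is_ideal P" "H \<subseteq> P" "\<And>Q. prime_ideal Q \<Longrightarrow> H \<subseteq> Q \<Longrightarrow> Q \<subseteq> P \<Longrightarrow> Q = P"
  using assms prime_ideal_is_ideal by (auto simp: minimal_primes_def)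

lemma minimal_primes_plus_y:
  "minimal_primes (plus_y I :: (('n, 'm) tvar, 'k::comm_ring_1) mpoly set) = plus_y ` minimal_primes I"
proof
  show "minimal_primes (plus_y I :: (('n, 'm) tvar, 'k) mpoly set) \<subseteq> plus_y ` minimal_primes I"
  proof
    fix Q :: "(('n, 'm) tvar, 'k) mpoly set"
    assume Q: "Q \<in> minimal_primes (plus_y I)"
    note c = contraction_over_plus_y[OF minimal_primesD(1,3)[OF Q]]
    obtain P where P: "P \<in> minimal_primes I" "P \<subseteq> S_to_T -` Q"
      using minimal_prime_below[OF c(1,2)] by blast
    have "plus_y P \<subseteq> Q" using plus_y_mono[OF P(2)] c(3) by blast
    then have "plus_y P = Q"
      by (intro minimal_primesD(4)[OF Q] prime_plus_y minimal_primesD(1)[OF P(1)]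
          plus_y_mono minimal_primesD(3)[OF P(1)])
    then show "Q \<in> plus_y ` minimal_primes I" using P(1) by blast
  qed
  show "plus_y ` minimal_primes I \<subseteq> minimal_primes (plus_y I :: (('n, 'm) tvar, 'k) mpoly set)"
  proof clarify
    fix P assume P: "P \<in> minimal_primes I"
    note p = minimal_primesD[OF P]
    have "Q = plus_y P" if Q: "prime_ideal Q" "plus_y I \<subseteq> Q" "Q \<subseteq> plus_y P"
      for Q :: "(('n, 'm) tvar, 'k) mpoly set"
    proof -
      note c = contraction_over_plus_y[OF Q(1,2)]
      have "S_to_T -` Q \<subseteq> P" using Q(3) S_to_T_in_plus_y_iff[OF p(2), where ?'m = 'm] by blast
      then have "S_to_T -` Q = P" using p(4)[OF c(1,2)] by blast
      then show ?thesis using c(3) Q(3) by blast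
    qed
    then show "plus_y P \<in> minimal_primes (plus_y I :: (('n, 'm) tvar, 'k) mpoly set)"
      using prime_plus_y[OF p(1)] plus_y_mono[OF p(3)] by (auto simp: minimal_primes_def)
  qed
qed

lemma inj_on_plus_y:
  "inj_on (plus_y :: _ \<Rightarrow> (('n, 'm) tvar, 'k::comm_ring_1) mpoly set) (minimal_primes I)"
proof (rule inj_onI)
  fix P P' assume P: "P \<in> minimal_primes I" "P' \<in> minimal_primes I"
    and eq: "(plus_y P :: (('n, 'm) tvar, 'k) mpoly set) = plus_y P'"
  show "P = P'"
    using S_to_T_in_plus_y_iff[OF minimal_primesD(2)[OF P(1)], where ?'m = 'm]
      S_to_T_in_plus_y_iff[OF minimal_primesD(2)[OF P(2)], where ?'m = 'm] eq by blast
qed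

lemma height_plus_y:
  fixes I :: "('n::finite, 'k::field) mpoly set"
  shows "height (plus_y I :: (('n, 'm::finite) tvar, 'k) mpoly set) = enat (CARD('m)) + height I"
    (is "height ?PY = _")
proof (rule antisym)
  show "enat (CARD('m)) + height I \<le> height ?PY"
    unfolding height_def[of ?PY]
  proof (rule INF_greatest, clarify)
    fix Q :: "(('n, 'm) tvar, 'k) mpoly set" assume Q: "prime_ideal Q" "?PY \<subseteq> Q"
    note c = contraction_over_plus_y[OF Q]
    have "height I \<le> prime_height (S_to_T -` Q)"
      unfolding height_def using c by (intro INF_lower) auto
    then have "enat (CARD('m)) + height I \<le> enat (CARD('m)) + prime_height (S_to_T -` Q)"
      by (rule add_left_mono)
    also have "\<dots> \<le> prime_height Q"
      unfolding prime_height_plus_y[OF c(1), symmetric] by (rule prime_height_mono[OF Q(1) c(3)])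
    finally show "enat (CARD('m)) + height I \<le> prime_height Q" .
  qed
  show "height ?PY \<le> enat (CARD('m)) + height I"
  proof (cases "{P. prime_ideal P \<and> I \<subseteq> P} = {}")
    case True
    then have "height I = \<infinity>" unfolding height_def by (simp only: image_empty Inf_empty top_enat_def)
    then show ?thesis by simp
  next
    case False
    then obtain P0 where "P0 \<in> {P. prime_ideal P \<and> I \<subseteq> P}" by blast
    then have "height I \<in> prime_height ` {P. prime_ideal P \<and> I \<subseteq> P}"
      unfolding height_def by (intro wellorder_InfI[of "prime_height P0"]) (rule imageI)
    then obtain P where P: "prime_ideal P" "I \<subseteq> P" "height I = prime_height P" by blast
    have "height ?PY \<le> prime_height (plus_y P :: (('n, 'm) tvar, 'k) mpoly set)"
      unfolding height_def using prime_plus_y[OF P(1)] plus_y_mono[OF P(2)] by (intro INF_lower) auto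
    then show ?thesis by (simp add: prime_height_plus_y[OF P(1)] P(3))
  qed
qed

theorem theorem2p4:
  fixes I :: "('n::finite, 'k::field_char_0) mpoly set"
    and f :: "'m::finite \<Rightarrow> ('n, 'k) mpoly"
    and G J :: "(('n, 'm) tvar, 'k) mpoly set"
  assumes "homogeneous_ideal I" and "I \<noteq> {0}" and "I \<noteq> UNIV"
    and "minimal_homogeneous_generators f I"
    and "ideal_span G = RLP f"
    and "J = singular_ideal f G"
  shows "J = (\<Inter>\<pp>\<in>minimal_primes I. plus_y \<pp>) \<and>
         bij_betw plus_y (minimal_primes I) (minimal_primes J) \<and>
         height J = enat (mu I) + height I \<and>
         codim_in (RLP f) J = height I"
proof -
  have I: "ideal_span (range f) = I" and m: "CARD('m) = mu I"
    using assms(4) by (auto simp: minimal_homogeneous_generators_def)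
  let ?PY = "plus_y I :: (('n, 'm) tvar, 'k) mpoly set"
  let ?H = "ideal_span (RLP f \<union> jacobian_minors G)"
  have J: "J = \<Inter>{Q. prime_ideal Q \<and> ?H \<subseteq> Q}"
    unfolding assms(6) singular_ideal_def by (rule radical_eq_Inter_primes[OF is_ideal_span])
  have "\<exists>k. f k \<noteq> 0"
  proof (rule ccontr)
    assume "\<nexists>k. f k \<noteq> 0"
    then have "ideal_span (range f) \<subseteq> {0}"
      by (intro ideal_span_minimal) (auto simp: ideal.subspace_def)
    then show False using I assms(2) is_ideal_zero[OF is_ideal_span, of "range f"] by blast
  qed
  then obtain k where "f k \<noteq> 0" ..
  note over = prime_over_singular_iff[OF assms(5) this, unfolded I]
  have "?H \<subseteq> J" unfolding J by blast
  then have overJ: "J \<subseteq> Q \<longleftrightarrow> ?PY \<subseteq> Q" if "prime_ideal Q" for Q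
    using over[OF that] that unfolding J by blast
  have minJ: "minimal_primes J = minimal_primes ?PY" and hJ: "height J = height ?PY"
    unfolding minimal_primes_def height_def using overJ by (metis (no_types, lifting))+
  have "J = \<Inter>(minimal_primes ?PY)"
  proof
    show "J \<subseteq> \<Inter>(minimal_primes ?PY)"
      using overJ minimal_primesD by blast
    show "\<Inter>(minimal_primes ?PY) \<subseteq> J"
    proof
      fix a assume a: "a \<in> \<Inter>(minimal_primes ?PY)"
      have "a \<in> Q" if "prime_ideal Q" "?H \<subseteq> Q" for Q
      proof -
        have "?PY \<subseteq> Q" using over that by blast
        with minimal_prime_below[OF that(1)] obtain P where "P \<in> minimal_primes ?PY" "P \<subseteq> Q" by blast
        then show ?thesis using a by blast
      qed
      then show "a \<in> J" unfolding J by blast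
    qed
  qed
  then have "J = (\<Inter>\<pp>\<in>minimal_primes I. plus_y \<pp>)"
    by (simp only: minimal_primes_plus_y)
  moreover have "bij_betw plus_y (minimal_primes I) (minimal_primes J)"
    unfolding minJ minimal_primes_plus_y by (rule bij_betw_imageI[OF inj_on_plus_y refl])
  moreover have h: "height J = enat (mu I) + height I"
    unfolding hJ height_plus_y m ..
  moreover have "codim_in (RLP f) J = height I"
    unfolding codim_in_def h height_prime[OF prime_RLP] prime_height_RLP m
    by (cases "height I") auto
  ultimately show ?thesis by blast
qed

end
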